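(* Let $\lambda$ be a partition, let $n\ge \ell(\lambda)$, and let $M\in\mathrm{MLQ}(\lambda,n)$. Then \[\operatorname{maj}(M)=\operatorname{charge}(\rho_Q(M)).\]
   Context: Partitions and tableaux. For a partition $\lambda$, $\lambda'$ is its conjugate ($\lambda'_i=\#\{j:\lambda_j\ge i\}$) and $\ell(\lambda)$ its number of nonzero parts. Young diagrams are in French notation: row 1 is at the bottom, row $i$ has $\lambda_i$ left-justified boxes. A semistandard Young tableau (SSYT) of shape $\lambda$ is a filling by positive integers weakly increasing left to right in rows and strictly increasing bottom to top in columns; its content is $(c_1,c_2,\dots)$ with $c_i$ the number of entries $i$. The row reading word $\mathrm{rrw}(T)$ reads the rows from top to bottom, each row left to right. Binary matrices and multiline queues. For positive integers $L,n$, $\mathcal M(L,n)$ is the set of tuples $B=(B_1,\dots,B_L)$ of subsets of $[n]$, drawn as an $L\times n$ grid with rows $1,\dots,L$ from bottom to top, columns $1,\dots,n$ from left to right, and a ball in cell $(r,j)$ iff $j\in B_r$. For a partition $\lambda$ with $L=\lambda_1$ and $n\ge\ell(\lambda)$, $\mathrm{MLQ}(\lambda,n)$ is the set of $B\in\mathcal M(L,n)$ with $|B_j|=\lambda'_j$ for all $j$. A binary matrix whose top rows are empty is identified with the tuple obtained by deleting those empty rows. The column word $\mathrm{cw}(B)$ scans columns from left to right and, within each column, cells from top to bottom, recording the row number of each ball. Bracketing. For a word $w$ in positive integers and $i\ge1$, $\mathrm{Par}_i(w)$ is obtained by reading $w$ left to right, writing "(" for each letter $i+1$ and ")" for each letter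 $i$ (other letters ignored), and iteratively matching a "(" with a ")" to its right whenever they are adjacent or only already-matched parentheses lie between them. Letters $i,i+1$ of $w$ whose parentheses remain unmatched are called unmatched. Ferrari–Martin labelling and major index. Let $M\in\mathrm{MLQ}(\lambda,n)$, $L=\lambda_1$. For $r=L,L-1,\dots,2$: every not-yet-labelled ball of row $r$ receives label $r$; then the balls of row $r$ are processed in order of decreasing label (left to right among equal labels), each being paired with the first not-yet-labelled ball of row $r-1$ weakly to its right, scanning cyclically (columns $j,j+1,\dots,n,1,2,\dots$); that ball receives the same label. A pairing wraps if the ball found in row $r-1$ lies in a column strictly left of the ball in row $r$. Finally unlabelled balls of row 1 get label 1. Then $\operatorname{maj}(M)=\sum_p(\ell(p)-r(p)+1)$ over all wrapping pairings $p$, where $r(p)$ is the row of the upper ball of $p$ and $\ell(p)$ its label. $M$ is nonwrapping if $\operatorname{maj}(M)=0$; $\mathrm{MLQ}_0(\lambda,n)$ denotes the set of nonwrapping elements of $\mathrm{MLQ}(\lambda,n)$. Charge. The charge of a permutation $\tau$ of $[m]$ in one-line notation is $\sum (m-i)$ over those $i\in[m-1]$ such that $i$ appears to the left of $i+1$ in $\tau$. A word $w$ has partition content $\mu$ if its letters are $1,\dots,k$ and the number $\mu_i$ of letters $i$ satisfies $\mu_1\ge\mu_2\ge\cdots$. Its charge subwords are extracted as follows: scan $w$ from left to right to find the leftmost occurrence of its largest letter $k$, then continue to the right cyclically (wrapping to the start when needed) to find the next occurrence of $k-1$, then of $k-2$, and so on down to $1$; these $k$ letters, in their order of position in $w$,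 form $w^{(1)}$, viewed as a permutation of $[k]$. Remove them and repeat on the remaining letters to get $w^{(2)},w^{(3)},\dots$. Then $\operatorname{charge}(w)=\sum_i\operatorname{charge}(w^{(i)})$. For a SSYT $T$ with partition content, $\operatorname{charge}(T)=\operatorname{charge}(\mathrm{rrw}(T))$. Collapsing. For $B\in\mathcal M(L,n)$ and $1\le i\le L-1$, a ball in row $i+1$ is unmatched above if its letter $i+1$ in $\mathrm{cw}(B)$ is unmatched in $\mathrm{Par}_i(\mathrm{cw}(B))$. The operator $e_i^\star$ moves every ball of row $i+1$ that is unmatched above down to the (necessarily empty) cell of row $i$ in the same column. Products of operators act right to left, and $e^\star_{[a,b]}=e^\star_a e^\star_{a+1}\cdots e^\star_b$. Define $\rho_N(B)=e^\star_{[1,L-1]}e^\star_{[1,L-2]}\cdots e^\star_{[1,1]}(B)$. For $1\le k\le L$ let $N^{(k)}$ be the bottom $k$ rows of $e^\star_{[1,k-1]}\cdots e^\star_{[1,1]}(B)$ (so $N^{(1)}=(B_1)$), and let $N^{(0)}$ be empty. The recording tableau $\rho_Q(B)$ is the filling whose row $r$ (from the bottom) contains, for each $i=1,\dots,L$, exactly $|N^{(i)}_r|-|N^{(i-1)}_r|$ entries equal to $i$ (with $|N^{(i-1)}_i|=0$), arranged weakly increasingly; $\rho(B)=(\rho_N(B),\rho_Q(B))$. *)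

theory Defs
  imports Main
begin

definition is_partition :: "nat list \<Rightarrow> bool" where
  "is_partition lam \<longleftrightarrow> sorted_wrt (\<ge>) lam \<and> (\<forall>x\<in>set lam. 0 < x)"

definition part1 :: "nat list \<Rightarrow> nat" where
  "part1 lam = (case lam of [] \<Rightarrow> 0 | x # _ \<Rightarrow> x)"

definition conjp :: "nat list \<Rightarrow> nat \<Rightarrow> nat" where
  "conjp lam j = length (filter (\<lambda>x. j \<le> x) lam)"

text \<open>A binary matrix B in M(L,n) is a list of L sets; row r (1-based, bottom to
  top) is B ! (r-1).\<close>
definition row :: "nat set list \<Rightarrow> nat \<Rightarrow> nat set" where
  "row B r = B ! (r - 1)"

definition MLQ :: "nat list \<Rightarrow> nat \<Rightarrow> nat set list set" where
  "MLQ lam n = {B. length B = part1 lam \<and>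
      (\<forall>r\<in>{1..length B}. row B r \<subseteq> {1..n} \<and> card (row B r) = conjp lam r)}"

definition cw_cells :: "nat \<Rightarrow> nat set list \<Rightarrow> (nat \<times> nat) list" where
  "cw_cells n B = concat (map (\<lambda>j. map (\<lambda>r. (r, j))
       (filter (\<lambda>r. j \<in> row B r) (rev [1..<length B + 1]))) [1..<n + 1])"

definition cw :: "nat \<Rightarrow> nat set list \<Rightarrow> nat list" where
  "cw n B = map fst (cw_cells n B)"

text \<open>Positions (0-based) of unmatched letters i, i+1 in Par_i(w), computed by the
  usual left-to-right stack matching (letter i+1 = "(", letter i = ")").
  The argument k is the current position, st the stack of open positions.\<close>
fun unm :: "nat \<Rightarrow> nat list \<Rightarrow> nat \<Rightarrow> nat list \<Rightarrow> nat set" where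
  "unm i [] k st = set st"
| "unm i (x # w) k st =
     (if x = Suc i then unm i w (Suc k) (k # st)
      else if x = i then
        (case st of [] \<Rightarrow> insert k (unm i w (Suc k) [])
                  | _ # st' \<Rightarrow> unm i w (Suc k) st')
      else unm i w (Suc k) st)"

definition unmatched_pos :: "nat \<Rightarrow> nat list \<Rightarrow> nat set" where
  "unmatched_pos i w = unm i w 0 []"

definition e_star :: "nat \<Rightarrow> nat \<Rightarrow> nat set list \<Rightarrow> nat set list" where
  "e_star n i B =
     (let w = cw n B; cells = cw_cells n B;
          U = {snd (cells ! k) | k. k \<in> unmatched_pos i w \<and> w ! k = Suc i}
      in B[i - 1 := B ! (i - 1) \<union> U, i := B ! i - U])"

definition e_range :: "nat \<Rightarrow> nat \<Rightarrow> nat \<Rightarrow> nat set list \<Rightarrow> nat set list" where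
  "e_range n a b B = fold (e_star n) (rev [a..<b + 1]) B"

definition collapse_upto :: "nat \<Rightarrow> nat \<Rightarrow> nat set list \<Rightarrow> nat set list" where
  "collapse_upto n k B = fold (\<lambda>m. e_range n 1 m) [1..<k] B"

definition rhoN :: "nat \<Rightarrow> nat set list \<Rightarrow> nat set list" where
  "rhoN n B = collapse_upto n (length B) B"

definition Nk :: "nat \<Rightarrow> nat set list \<Rightarrow> nat \<Rightarrow> nat set list" where
  "Nk n B k = take k (collapse_upto n k B)"

definition card_row :: "nat set list \<Rightarrow> nat \<Rightarrow> nat" where
  "card_row N r = (if 1 \<le> r \<and> r \<le> length N then card (row N r) else 0)"

text \<open>A tableau is a list of rows, bottom row first.\<close>
definition rhoQ :: "nat \<Rightarrow> nat set list \<Rightarrow> nat list list" where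
  "rhoQ n B = map (\<lambda>r. concat (map (\<lambda>i. replicate
        (card_row (Nk n B i) r - card_row (Nk n B (i - 1)) r) i) [1..<length B + 1]))
      [1..<length B + 1]"

definition rrw :: "nat list list \<Rightarrow> nat list" where
  "rrw T = concat (rev T)"

definition perm_charge :: "nat list \<Rightarrow> nat" where
  "perm_charge \<tau> = (let m = length \<tau> in
     \<Sum>i\<in>{1..<m}. if (\<exists>a b. a < b \<and> b < m \<and> \<tau> ! a = i \<and> \<tau> ! b = Suc i) then m - i else 0)"

definition first_cyc :: "nat list \<Rightarrow> nat \<Rightarrow> nat \<Rightarrow> nat" where
  "first_cyc ws s a = (let I = {j. j < length ws \<and> ws ! j = a} in
     if (\<exists>j\<in>I. s \<le> j) then Min {j\<in>I. s \<le> j} else Min I)"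

fun chain_pos :: "nat list \<Rightarrow> nat \<Rightarrow> nat \<Rightarrow> nat list" where
  "chain_pos ws 0 p = []"
| "chain_pos ws (Suc a) p = (let q = first_cyc ws p (Suc a) in q # chain_pos ws a q)"

text \<open>Charge of a word, extracting charge subwords one at a time (the fuel
  argument is the length of the word, each round removes at least one letter).\<close>
fun charge_aux :: "nat \<Rightarrow> nat list \<Rightarrow> nat" where
  "charge_aux 0 ws = 0"
| "charge_aux (Suc f) ws =
     (if ws = [] then 0 else
      (let k = Max (set ws); P = set (chain_pos ws k 0) in
        perm_charge (map ((!) ws) (sorted_list_of_set P))
        + charge_aux f [ws ! j. j \<leftarrow> [0..<length ws], j \<notin> P]))"

definition charge_word :: "nat list \<Rightarrow> nat" where
  "charge_word w = charge_aux (length w) w"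

definition charge_tab :: "nat list list \<Rightarrow> nat" where
  "charge_tab T = charge_word (rrw T)"

definition cyc_next :: "nat set \<Rightarrow> nat \<Rightarrow> nat" where
  "cyc_next S j = (if (\<exists>c\<in>S. j \<le> c) then Min {c\<in>S. j \<le> c} else Min S)"

text \<open>Labels: (row, column) \<Rightarrow> label option; the second component accumulates maj.\<close>
type_synonym fm_state = "((nat \<times> nat) \<Rightarrow> nat option) \<times> nat"

definition fm_pair :: "nat set list \<Rightarrow> nat \<Rightarrow> nat \<Rightarrow> fm_state \<Rightarrow> fm_state" where
  "fm_pair B r j st = (let lab = fst st; m = snd st; l = the (lab (r, j));
       S = {c \<in> row B (r - 1). lab (r - 1, c) = None}; c = cyc_next S j
     in (lab((r - 1, c) := Some l), m + (if c < j then l + 1 - r else 0)))"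

definition fm_row :: "nat set list \<Rightarrow> nat \<Rightarrow> fm_state \<Rightarrow> fm_state" where
  "fm_row B r st = (let L = length B;
       lab1 = (\<lambda>(r', j). if r' = r \<and> j \<in> row B r \<and> fst st (r', j) = None
                        then Some r else fst st (r', j));
       order = concat (map (\<lambda>l. filter (\<lambda>j. lab1 (r, j) = Some l)
                    (sorted_list_of_set (row B r))) (rev [r..<L + 1]))
     in fold (fm_pair B r) order (lab1, snd st))"

definition maj :: "nat set list \<Rightarrow> nat" where
  "maj B = snd (fold (fm_row B) (rev [2..<length B + 1]) (\<lambda>_. None, 0))"

end

theory Submission
  imports Defs "HOL-Library.Multiset"
begin

text \<open>Both statistics count wraps in cyclic parking.  Fix a threshold \<open>l\<close> and let all balls of row
  \<open>l\<close> fall through the rows below, each parking in the next free ball cyclically to the right.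
  In every row the set of balls reached and the number of wraps do not depend on the order in which
  the balls are processed, and summing the wraps over all \<open>l\<close> gives \<open>maj M\<close>, as the weight
  of a wrapping pairing counts the thresholds it contributes to.  For a word, with the positions of
  the letters \<open>r\<close> as row \<open>r\<close>, the same sum is the charge: a charge subword is a chain of balls
  that may be processed first.  The sum is invariant under Knuth moves, since only a swap of adjacent
  letters \<open>i\<close>, \<open>i + 1\<close> matters and the third letter of the move absorbs it.  Finally the collapsing
  operators respect Knuth equivalence, and applied to the reading word of a tableau \<open>T\<close> they
  record \<open>T\<close> itself; as the column word of \<open>M\<close> is Knuth equivalent to such a reading word,
  \<open>rhoQ M\<close> is that tableau.\<close>

section \<open>Cyclic parking\<close>

text \<open>The same statistic has to be evaluated on columns of a matrix, on positions in a word,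
  and on positions renumbered after letters were deleted. Hence rows are arbitrary sets of naturals,
  and the transport lemmas isolate the only data that enter: the order inside each row, and the weak
  comparisons \<open>c \<le> s\<close> between a ball and a ball one row below. Everything rests on
  each row having room for all balls falling onto it, which holds for partition content because rows
  shrink upwards. The obstacle is a swap of adjacent letters \<open>i\<close> and
  \<open>Suc i\<close>: it changes which balls pair and sometimes the set reached in row
  \<open>i\<close>. The third letter of the Knuth move confines the damage to a change between
  columns that row \<open>i - 1\<close> cannot tell apart. As for collapsing, an arbitrary matrix is
  hard to follow, while a tableau word evolves explicitly; since only the numbers of balls per row
  enter \<open>rhoQ\<close>, following the word up to Knuth equivalence is enough.\<close>

primrec park :: "nat list \<Rightarrow> nat set \<Rightarrow> nat set" where
  "park [] S = S"
| "park (c # cs) S = park cs (S - {cyc_next S c})"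

primrec wraps :: "nat list \<Rightarrow> nat set \<Rightarrow> nat" where
  "wraps [] S = 0"
| "wraps (c # cs) S = of_bool (cyc_next S c < c) + wraps cs (S - {cyc_next S c})"

lemma cyc_next_cases:
  assumes "finite S" "S \<noteq> {}"
  shows "cyc_next S c \<in> S \<and>
    (c \<le> cyc_next S c \<and> (\<forall>s\<in>S. c \<le> s \<longrightarrow> cyc_next S c \<le> s) \<or>
     cyc_next S c < c \<and> (\<forall>s\<in>S. s < c \<and> cyc_next S c \<le> s))"
proof (cases "\<exists>s\<in>S. c \<le> s")
  case True
  let ?A = "{s\<in>S. c \<le> s}"
  have "finite ?A" "?A \<noteq> {}" using assms True by auto
  then have "Min ?A \<in> ?A" "\<forall>s\<in>?A. Min ?A \<le> s" using Min_in by auto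
  then show ?thesis using True by (auto simp: cyc_next_def)
next
  case False
  have "Min S \<in> S" "\<forall>s\<in>S. Min S \<le> s" using assms by auto
  moreover have "cyc_next S c = Min S" using False by (auto simp: cyc_next_def)
  ultimately show ?thesis using False by (auto simp: not_le)
qed

lemma cyc_next_in: "finite S \<Longrightarrow> S \<noteq> {} \<Longrightarrow> cyc_next S c \<in> S"
  using cyc_next_cases by blast

lemma cyc_next_ahead:
  assumes "finite S" "d \<in> S" "c \<le> d" "\<And>s. s \<in> S \<Longrightarrow> c \<le> s \<Longrightarrow> d \<le> s"
  shows "cyc_next S c = d"
proof -
  have "S \<noteq> {}" using assms(2) by auto
  then consider "cyc_next S c \<in> S" "c \<le> cyc_next S c" "cyc_next S c \<le> d" | "d < c"
    using cyc_next_cases[OF assms(1), of c] assms(2,3) by blast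
  then show ?thesis using assms(3,4) by cases (simp_all add: antisym)
qed

lemma cyc_next_wrapped:
  assumes "finite S" "d \<in> S" "\<And>s. s \<in> S \<Longrightarrow> s < c" "\<And>s. s \<in> S \<Longrightarrow> d \<le> s"
  shows "cyc_next S c = d"
proof -
  have "S \<noteq> {}" using assms(2) by auto
  then have *: "cyc_next S c \<in> S"
    "c \<le> cyc_next S c \<or> (\<forall>s\<in>S. cyc_next S c \<le> s)"
    using cyc_next_cases[OF assms(1), of c] by auto
  have "cyc_next S c < c" using assms(3) *(1) .
  then have "cyc_next S c \<le> d" using *(2) assms(2) by auto
  then show ?thesis using assms(4)[OF *(1)] by (rule antisym)
qed

lemma cyc_next_delete_other:
  assumes "finite S" "x \<noteq> cyc_next S c" "S \<noteq> {}"
  shows "cyc_next (S - {x}) c = cyc_next S c"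
proof -
  consider "c \<le> cyc_next S c" "\<forall>s\<in>S. c \<le> s \<longrightarrow> cyc_next S c \<le> s"
    | "cyc_next S c < c" "\<forall>s\<in>S. s < c \<and> cyc_next S c \<le> s"
    using cyc_next_cases[of S c] assms by blast
  then show ?thesis
  proof cases
    case 1
    then show ?thesis using cyc_next_in[of S c] assms by (intro cyc_next_ahead) auto
  next
    case 2
    then show ?thesis using cyc_next_in[of S c] assms by (intro cyc_next_wrapped) auto
  qed
qed

text \<open>Different targets do not interfere. If both balls aim at \<open>d\<close>, whichever
  comes second continues to the same next place \<open>e\<close>. Going on from \<open>d\<close> to
  \<open>e\<close> costs one wrap exactly when \<open>e < d\<close>, for either ball, because a ball
  that already wrapped to reach \<open>d\<close> has reached the minimum of \<open>S\<close>. So the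
  total is symmetric in \<open>c\<close> and \<open>c'\<close>.\<close>

lemma park_swap:
  assumes "finite S" "2 \<le> card S"
  shows "park [c, c'] S = park [c', c] S \<and> wraps [c, c'] S = wraps [c', c] S"
proof -
  have ne: "S \<noteq> {}" using assms by auto
  define d where "d = cyc_next S c"
  define d' where "d' = cyc_next S c'"
  show ?thesis
  proof (cases "d = d'")
    case False
    then show ?thesis
      using cyc_next_delete_other[of S d c'] cyc_next_delete_other[of S d' c] assms(1) ne
      by (auto simp: d_def d'_def)
  next
    case True
    define T where "T = S - {d}"
    have T: "finite T" using assms by (auto simp: T_def)
    have dS: "d \<in> S" using cyc_next_in assms ne by (auto simp: d_def)
    then have "card T \<ge> 1" using assms by (simp add: T_def)
    then have Tne: "T \<noteq> {}" by auto
    define e where "e = cyc_next T c"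
    define e' where "e' = cyc_next T c'"
    have D: "d \<notin> T" "S = insert d T" using dS by (auto simp: T_def)
    note C1 = cyc_next_cases[OF assms(1) ne, of c, folded d_def]
    note C2 = cyc_next_cases[OF assms(1) ne, of c', folded d'_def, folded True]
    note C3 = cyc_next_cases[OF T Tne, of c, folded e_def]
    note C4 = cyc_next_cases[OF T Tne, of c', folded e'_def]
    have inst: "e \<in> S" "e' \<in> S" "e \<in> T" "e' \<in> T" "e \<noteq> d" "e' \<noteq> d" using C3 C4 D by auto
    \<comment> \<open>Only the comparisons with \<open>e\<close> and \<open>e'\<close> are kept from
      the universal statements; what remains is a finite problem in a linear order.\<close>
    have h: "c \<le> d \<and> (c \<le> e \<longrightarrow> d \<le> e) \<and> (c \<le> e' \<longrightarrow> d \<le> e') \<or> d < c \<and> e < c \<and> d \<le> e \<and> e' < c \<and> d \<le> e'"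
      "c' \<le> d \<and> (c' \<le> e \<longrightarrow> d \<le> e) \<and> (c' \<le> e' \<longrightarrow> d \<le> e') \<or> d < c' \<and> e < c' \<and> d \<le> e \<and> e' < c' \<and> d \<le> e'"
      "c \<le> e \<and> (c \<le> e' \<longrightarrow> e \<le> e') \<or> e < c \<and> e' < c \<and> e \<le> e'"
      "c' \<le> e' \<and> (c' \<le> e \<longrightarrow> e' \<le> e) \<or> e' < c' \<and> e < c' \<and> e' \<le> e"
      subgoal using C1 inst(1,2) by (elim conjE disjE) simp_all
      subgoal using C2 inst(1,2) by (elim conjE disjE) simp_all
      subgoal using C3 inst(4) by (elim conjE disjE) simp_all
      subgoal using C4 inst(3) by (elim conjE disjE) simp_all
      done
    have "e = e'" using h inst(5,6) by (smt (verit) le_antisym le_less_trans nat_le_linear not_le)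
    moreover have "of_bool (d < c) + of_bool (e < c') = (of_bool (d < c') + of_bool (e < c) :: nat)"
      using h(1,2) inst(5) by (simp add: of_bool_def) linarith
    ultimately show ?thesis
      using True by (simp add: d_def d'_def T_def e_def e'_def)
  qed
qed

text \<open>Bubbles \<open>c\<close> to the front; the bound leaves two free places at every
  swap.\<close>

lemma park_move:
  assumes "finite S" "length us + Suc (length vs) \<le> card S"
  shows "park (us @ c # vs) S = park (c # us @ vs) S \<and> wraps (us @ c # vs) S = wraps (c # us @ vs) S"
  using assms
proof (induction us arbitrary: S)
  case Nil
  then show ?case by simp
next
  case (Cons u us)
  have ne: "S \<noteq> {}" using Cons.prems by auto
  have "card (S - {cyc_next S u}) = card S - 1"
    using cyc_next_in[OF Cons.prems(1) ne] Cons.prems(1) by simp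
  then have IH: "park (us @ c # vs) (S - {cyc_next S u}) = park (c # us @ vs) (S - {cyc_next S u})"
    "wraps (us @ c # vs) (S - {cyc_next S u}) = wraps (c # us @ vs) (S - {cyc_next S u})"
    using Cons.IH[of "S - {cyc_next S u}"] Cons.prems by auto
  have sw: "park [u, c] S = park [c, u] S" "wraps [u, c] S = wraps [c, u] S"
    using park_swap[of S u c] Cons.prems by auto
  show ?case using IH sw by (simp add: add.assoc[symmetric])
qed

lemma park_perm:
  assumes "finite S" "length cs \<le> card S" "mset cs = mset cs'"
  shows "park cs S = park cs' S \<and> wraps cs S = wraps cs' S"
  using assms
proof (induction cs arbitrary: S cs')
  case Nil
  then show ?case by simp
next
  case (Cons c cs)
  have "c \<in> set cs'" using Cons.prems(3) by (metis list.set_intros(1) mset_eq_setD)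
  then obtain us vs where cs': "cs' = us @ c # vs" by (meson split_list)
  have ne: "S \<noteq> {}" using Cons.prems by auto
  have "card (S - {cyc_next S c}) = card S - 1"
    using cyc_next_in[OF Cons.prems(1) ne] Cons.prems(1) by simp
  then have "park cs (S - {cyc_next S c}) = park (us @ vs) (S - {cyc_next S c})"
    "wraps cs (S - {cyc_next S c}) = wraps (us @ vs) (S - {cyc_next S c})"
    using Cons.IH[of "S - {cyc_next S c}" "us @ vs"] Cons.prems cs' by auto
  moreover have "length cs' = length (c # cs)" using Cons.prems(3) by (metis mset_eq_length)
  ultimately show ?case
    using park_move[of S us vs c] Cons.prems cs' by simp
qed

lemma park_subset: "park cs S \<subseteq> S"
proof (induction cs arbitrary: S)
  case (Cons c cs)
  have "park cs (S - {cyc_next S c}) \<subseteq> S - {cyc_next S c}" by (rule Cons.IH)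
  then show ?case by auto
qed simp

lemma card_park:
  assumes "finite S" "length cs \<le> card S"
  shows "card (park cs S) = card S - length cs"
  using assms
proof (induction cs arbitrary: S)
  case (Cons c cs)
  have "S \<noteq> {}" using Cons.prems by auto
  then have "card (S - {cyc_next S c}) = card S - 1"
    using cyc_next_in Cons.prems(1) by simp
  then show ?case using Cons by simp
qed simp

section \<open>Relabelling balls and places\<close>

lemma cyc_next_transport:
  assumes "finite S" "S \<noteq> {}" "strict_mono_on S g" "\<And>s. s \<in> S \<Longrightarrow> c \<le> s \<longleftrightarrow> c' \<le> g s"
  shows "cyc_next (g ` S) c' = g (cyc_next S c)"
proof -
  have mono: "s \<le> t \<Longrightarrow> g s \<le> g t" if "s \<in> S" "t \<in> S" for s t
    using assms(3) that by (metis le_eq_less_or_eq strict_mono_onD)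
  consider "c \<le> cyc_next S c" "\<forall>s\<in>S. c \<le> s \<longrightarrow> cyc_next S c \<le> s"
    | "cyc_next S c < c" "\<forall>s\<in>S. s < c \<and> cyc_next S c \<le> s"
    using cyc_next_cases[of S c] assms by blast
  then show ?thesis
  proof cases
    case 1
    then show ?thesis using assms cyc_next_in[of S c] mono
      by (intro cyc_next_ahead) auto
  next
    case 2
    have "g s < c'" if "s \<in> S" for s using 2 assms(4)[OF that] that by (meson not_le)
    then show ?thesis using 2 assms cyc_next_in[of S c] mono
      by (intro cyc_next_wrapped) auto
  qed
qed

text \<open>A choice depends only on the order among the places and on which places lie weakly to
  the right of the ball. So balls and places may be relabelled by different maps, and
  \<open>f\<close> may even permute the balls.\<close>

lemma park_transport:
  assumes "finite S" "length cs \<le> card S" "strict_mono_on S g"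
    "\<And>c s. c \<in> set cs \<Longrightarrow> s \<in> S \<Longrightarrow> c \<le> s \<longleftrightarrow> f c \<le> g s"
  shows "park (map f cs) (g ` S) = g ` park cs S \<and> wraps (map f cs) (g ` S) = wraps cs S"
  using assms
proof (induction cs arbitrary: S)
  case (Cons c cs)
  have ne: "S \<noteq> {}" using Cons.prems by auto
  let ?d = "cyc_next S c"
  have d: "?d \<in> S" using cyc_next_in[OF Cons.prems(1) ne] .
  have nx: "cyc_next (g ` S) (f c) = g ?d"
    using Cons.prems ne by (intro cyc_next_transport) auto
  have inj: "inj_on g S" using Cons.prems(3) by (rule strict_mono_on_imp_inj_on)
  have im: "g ` S - {g ?d} = g ` (S - {?d})" using inj d by (auto simp: inj_on_def)
  have sm: "strict_mono_on (S - {?d}) g"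
    using Cons.prems(3) by (auto simp: monotone_on_def)
  have "park (map f cs) (g ` (S - {?d})) = g ` park cs (S - {?d}) \<and>
    wraps (map f cs) (g ` (S - {?d})) = wraps cs (S - {?d})"
    using Cons.prems d sm by (intro Cons.IH) auto
  moreover have "g ?d < f c \<longleftrightarrow> ?d < c" using Cons.prems(4)[of c ?d] d by auto
  ultimately show ?case using nx im by simp
qed simp

text \<open>The increasing order is one choice of processing order; by \<open>park_perm\<close>
  every enumeration gives the same set and count as soon as there are enough places.\<close>

definition occ :: "nat set \<Rightarrow> nat set \<Rightarrow> nat set" where
  "occ C S = S - park (sorted_list_of_set C) S"

definition nwraps :: "nat set \<Rightarrow> nat set \<Rightarrow> nat" where
  "nwraps C S = wraps (sorted_list_of_set C) S"

lemma occ_nwraps_list: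
  assumes "finite S" "length cs \<le> card S" "distinct cs" "set cs = C"
  shows "occ C S = S - park cs S" "nwraps C S = wraps cs S"
proof -
  have "mset (sorted_list_of_set C) = mset cs"
    using assms by (intro set_eq_iff_mset_eq_distinct[THEN iffD1]) auto
  moreover have "length (sorted_list_of_set C) = length cs"
    using calculation by (metis mset_eq_length)
  ultimately show "occ C S = S - park cs S" "nwraps C S = wraps cs S"
    using park_perm[of S "sorted_list_of_set C" cs] assms by (auto simp: occ_def nwraps_def)
qed

lemma occ_subset: "occ C S \<subseteq> S"
  by (auto simp: occ_def)

lemma occ_transport:
  assumes "finite S" "finite C" "card C \<le> card S" "strict_mono_on S g" "inj_on f C"
    "\<And>c s. c \<in> C \<Longrightarrow> s \<in> S \<Longrightarrow> c \<le> s \<longleftrightarrow> f c \<le> g s"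
  shows "occ (f ` C) (g ` S) = g ` occ C S" "nwraps (f ` C) (g ` S) = nwraps C S"
proof -
  let ?cs = "sorted_list_of_set C"
  have inj: "inj_on g S" using assms(4) by (rule strict_mono_on_imp_inj_on)
  have P: "park (map f ?cs) (g ` S) = g ` park ?cs S \<and> wraps (map f ?cs) (g ` S) = wraps ?cs S"
    using assms by (intro park_transport) auto
  have D: "distinct (map f ?cs)" "set (map f ?cs) = f ` C"
    using assms by (auto simp: distinct_map)
  have len: "length (map f ?cs) \<le> card (g ` S)" using assms inj by (simp add: card_image)
  show "nwraps (f ` C) (g ` S) = nwraps C S"
    using occ_nwraps_list(2)[OF _ len D] assms(1) P by (simp add: nwraps_def)
  show "occ (f ` C) (g ` S) = g ` occ C S"
    using occ_nwraps_list(1)[OF _ len D] assms(1) P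
    by (simp add: occ_def inj_on_image_set_diff[OF inj _ park_subset])
qed

text \<open>Order independence used as a choice: any ball \<open>c\<close> may be sent first. The
  charge chains and the balls affected by a Knuth move are split off this way.\<close>

lemma occ_remove:
  assumes "finite S" "finite C" "card C \<le> card S" "c \<in> C"
  shows "occ C S = insert (cyc_next S c) (occ (C - {c}) (S - {cyc_next S c}))"
    "nwraps C S = of_bool (cyc_next S c < c) + nwraps (C - {c}) (S - {cyc_next S c})"
proof -
  have "card C > 0" using assms by (auto simp: card_gt_0_iff)
  then have ne: "S \<noteq> {}" using assms by auto
  note d = cyc_next_in[OF assms(1) ne, of c]
  let ?cs = "sorted_list_of_set (C - {c})"
  have len: "length (c # ?cs) \<le> card S" using assms \<open>card C > 0\<close> by simp
  have D: "distinct (c # ?cs)" "set (c # ?cs) = C" using assms by auto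
  show "occ C S = insert (cyc_next S c) (occ (C - {c}) (S - {cyc_next S c}))"
    using occ_nwraps_list(1)[OF assms(1) len D] d park_subset[of ?cs "S - {cyc_next S c}"]
    by (auto simp: occ_def)
  show "nwraps C S = of_bool (cyc_next S c < c) + nwraps (C - {c}) (S - {cyc_next S c})"
    using occ_nwraps_list(2)[OF assms(1) len D] by (simp add: nwraps_def)
qed

section \<open>Balls falling through a stack of rows\<close>

primrec fall :: "(nat \<Rightarrow> nat set) \<Rightarrow> nat \<Rightarrow> nat set \<Rightarrow> nat" where
  "fall R 0 C = 0"
| "fall R (Suc i) C = nwraps C (R (Suc i)) + fall R i (occ C (R (Suc i)))"

text \<open>Summand \<open>l\<close> belongs to the threshold \<open>Suc l\<close>: that row is the
  start and the \<open>l\<close> rows below it are crossed.\<close>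

definition layered :: "(nat \<Rightarrow> nat set) \<Rightarrow> nat \<Rightarrow> nat" where
  "layered R L = (\<Sum>l<L. fall R l (R (Suc l)))"

text \<open>The partition condition for an infinite sequence of rows. It guarantees room for every
  subset of the row above; index 0 is exempt because rows count from 1.\<close>

definition stack :: "(nat \<Rightarrow> nat set) \<Rightarrow> bool" where
  "stack R \<longleftrightarrow> (\<forall>r\<ge>1. finite (R r) \<and> card (R (Suc r)) \<le> card (R r))"

lemma stackD: "stack R \<Longrightarrow> r \<ge> 1 \<Longrightarrow> finite (R r)" "stack R \<Longrightarrow> r \<ge> 1 \<Longrightarrow> card (R (Suc r)) \<le> card (R r)"
  by (auto simp: stack_def)

text \<open>\<open>f\<close> acts on the starting balls alone, which are never landing places, so
  injectivity is enough. From the next row on its role is taken by the row map \<open>g\<close>,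
  which is monotone and hence injective.\<close>

lemma fall_transport:
  assumes "stack R" "C \<subseteq> R (Suc i)" "inj_on f C"
    "\<And>r. r \<in> {1..i} \<Longrightarrow> strict_mono_on (R r) (g r) \<and> R' r = g r ` R r"
    "\<And>c s. i \<ge> 1 \<Longrightarrow> c \<in> C \<Longrightarrow> s \<in> R i \<Longrightarrow> c \<le> s \<longleftrightarrow> f c \<le> g i s"
    "\<And>r c s. r \<in> {1..<i} \<Longrightarrow> c \<in> R (Suc r) \<Longrightarrow> s \<in> R r \<Longrightarrow> c \<le> s \<longleftrightarrow> g (Suc r) c \<le> g r s"
  shows "fall R' i (f ` C) = fall R i C"
  using assms
proof (induction i arbitrary: C f)
  case (Suc i)
  let ?S = "R (Suc i)"
  have fS: "finite ?S" "finite C" using stackD[OF Suc.prems(1)] Suc.prems(2) by (auto intro: finite_subset)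
  have "card C \<le> card (R (Suc (Suc i)))" using Suc.prems(2) stackD[OF Suc.prems(1)] by (simp add: card_mono)
  also have "\<dots> \<le> card ?S" using stackD(2)[OF Suc.prems(1), of "Suc i"] by simp
  finally have cC: "card C \<le> card ?S" .
  have g: "strict_mono_on ?S (g (Suc i))" "R' (Suc i) = g (Suc i) ` ?S" using Suc.prems(4) by auto
  have T: "occ (f ` C) (R' (Suc i)) = g (Suc i) ` occ C ?S" "nwraps (f ` C) (R' (Suc i)) = nwraps C ?S"
    unfolding g(2) using occ_transport[OF fS cC g(1) Suc.prems(3)] Suc.prems(5) by auto
  have sub: "occ C ?S \<subseteq> ?S" by (rule occ_subset)
  have "fall R' i (g (Suc i) ` occ C ?S) = fall R i (occ C ?S)"
  proof (rule Suc.IH[OF Suc.prems(1) sub])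
    show "inj_on (g (Suc i)) (occ C ?S)"
      using strict_mono_on_imp_inj_on[OF g(1)] sub by (rule inj_on_subset)
    show "strict_mono_on (R r) (g r) \<and> R' r = g r ` R r" if "r \<in> {1..i}" for r
      using Suc.prems(4)[of r] that by simp
    show "c \<le> s \<longleftrightarrow> g (Suc i) c \<le> g i s" if "1 \<le> i" "c \<in> occ C ?S" "s \<in> R i" for c s
      using Suc.prems(6)[of i c s] that sub by auto
    show "c \<le> s \<longleftrightarrow> g (Suc r) c \<le> g r s" if "r \<in> {1..<i}" "c \<in> R (Suc r)" "s \<in> R r" for r c s
      using Suc.prems(6)[of r c s] that by simp
  qed
  then show ?case using T by simp
qed simp

lemma layered_transport:
  assumes "stack R" "\<And>r. r \<ge> 1 \<Longrightarrow> strict_mono_on (R r) (g r) \<and> R' r = g r ` R r"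
    "\<And>r c s. r \<ge> 1 \<Longrightarrow> c \<in> R (Suc r) \<Longrightarrow> s \<in> R r \<Longrightarrow> c \<le> s \<longleftrightarrow> g (Suc r) c \<le> g r s"
  shows "layered R' L = layered R L"
  unfolding layered_def
proof (intro sum.cong refl)
  fix l
  have "R' (Suc l) = g (Suc l) ` R (Suc l)" "inj_on (g (Suc l)) (R (Suc l))"
    using assms(2)[of "Suc l"] strict_mono_on_imp_inj_on by auto
  moreover have "fall R' l (g (Suc l) ` R (Suc l)) = fall R l (R (Suc l))"
  proof (rule fall_transport[OF assms(1) subset_refl])
    show "strict_mono_on (R r) (g r) \<and> R' r = g r ` R r" if "r \<in> {1..l}" for r
      using assms(2)[of r] that by simp
    show "c \<le> s \<longleftrightarrow> g (Suc l) c \<le> g l s" if "1 \<le> l" "c \<in> R (Suc l)" "s \<in> R l" for c s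
      using assms(3)[OF that] .
    show "c \<le> s \<longleftrightarrow> g (Suc r) c \<le> g r s" if "r \<in> {1..<l}" "c \<in> R (Suc r)" "s \<in> R r" for r c s
      using assms(3)[of r c s] that by simp
  qed (use calculation in simp)
  ultimately show "fall R' l (R' (Suc l)) = fall R l (R (Suc l))" by simp
qed

section \<open>The major index\<close>

text \<open>In terms of the labelling: the balls of row \<open>r\<close> whose label is at least
  \<open>t\<close>. In rows from \<open>t\<close> upwards every ball qualifies, which is the second
  branch.\<close>

function landing :: "(nat \<Rightarrow> nat set) \<Rightarrow> nat \<Rightarrow> nat \<Rightarrow> nat set" where
  "landing R t r = (if r < t then occ (landing R t (Suc r)) (R r) else R r)"
  by pat_completeness auto
termination by (relation "measure (\<lambda>(R, t, r). t - r)") auto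

declare landing.simps [simp del]

lemma landing_subset: "landing R t r \<subseteq> R r"
  using occ_subset by (subst landing.simps) auto

lemma fall_landing:
  assumes "i < t"
  shows "fall R i (landing R t (Suc i)) = (\<Sum>r\<in>{1..i}. nwraps (landing R t (Suc r)) (R r))"
  using assms
proof (induction i)
  case (Suc i)
  have "landing R t (Suc i) = occ (landing R t (Suc (Suc i))) (R (Suc i))"
    using Suc.prems by (subst landing.simps) simp
  then show ?case using Suc by (simp add: add.commute)
qed simp

text \<open>Regroups the wraps by the row they start from instead of by threshold, since the
  labelling works through the rows and handles all thresholds at once.\<close>

lemma layered_landing:
  "layered R L = (\<Sum>r\<in>{2..L}. \<Sum>t\<in>{r..L}. nwraps (landing R t r) (R (r - 1)))"
proof -
  have "layered R L = (\<Sum>l<L. \<Sum>r\<in>{1..l}. nwraps (landing R (Suc l) (Suc r)) (R r))"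
    unfolding layered_def
  proof (intro sum.cong refl)
    fix l
    have "landing R (Suc l) (Suc l) = R (Suc l)" by (subst landing.simps) simp
    then show "fall R l (R (Suc l)) = (\<Sum>r\<in>{1..l}. nwraps (landing R (Suc l) (Suc r)) (R r))"
      using fall_landing[of l "Suc l" R] by simp
  qed
  also have "\<dots> = (\<Sum>l<L. \<Sum>r\<in>{2..Suc l}. nwraps (landing R (Suc l) r) (R (r - 1)))"
    by (rule sum.cong[OF refl], rule sum.reindex_bij_witness[of _ "\<lambda>r. r - 1" Suc]) auto
  also have "\<dots> = (\<Sum>t\<in>{1..L}. \<Sum>r\<in>{2..t}. nwraps (landing R t r) (R (r - 1)))"
    by (rule sum.reindex_bij_witness[of _ "\<lambda>r. r - 1" Suc]) auto
  also have "\<dots> = (\<Sum>(t, r)\<in>(SIGMA t:{1..L}. {2..t}). nwraps (landing R t r) (R (r - 1)))"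
    by (simp add: sum.Sigma)
  also have "\<dots> = (\<Sum>(r, t)\<in>(SIGMA r:{2..L}. {r..L}). nwraps (landing R t r) (R (r - 1)))"
    by (rule sum.reindex_bij_witness[of _ prod.swap prod.swap]) auto
  also have "\<dots> = (\<Sum>r\<in>{2..L}. \<Sum>t\<in>{r..L}. nwraps (landing R t r) (R (r - 1)))"
    by (simp add: sum.Sigma)
  finally show ?thesis .
qed

section \<open>Ferrari-Martin pairing as parking\<close>

lemma park_append: "park (cs @ ds) S = park ds (park cs S)"
  by (induction cs arbitrary: S) auto

lemma wraps_append: "wraps (cs @ ds) S = wraps cs S + wraps ds (park cs S)"
  by (induction cs arbitrary: S) auto

definition rows :: "nat set list \<Rightarrow> nat \<Rightarrow> nat set" where
  "rows B r = (if 1 \<le> r \<and> r \<le> length B then row B r else {})"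

text \<open>The weight \<open>l + 1 - r\<close> of a wrapping pairing counts the thresholds \<open>t\<close> with
  \<open>r \<le> t \<le> l\<close>; for each threshold the balls with label at least \<open>t\<close> form an initial
  segment of the processing order.\<close>
lemma fold_fm_pair:
  assumes S: "finite (row B (r - 1))" "length cs \<le> card (row B (r - 1))" and r: "2 \<le> r"
    and none: "\<And>c. lab (r - 1, c) = None"
    and lbl: "\<And>c. lbl c = the (lab (r, c))"
    and srt: "sorted_wrt (\<lambda>a b. lbl b \<le> lbl a) cs"
    and rng: "\<And>c. c \<in> set cs \<Longrightarrow> r \<le> lbl c \<and> lbl c \<le> L"
    and res: "fold (fm_pair B r) cs (lab, m) = (lab', m')"
  shows "(\<forall>x. fst x \<noteq> r - 1 \<longrightarrow> lab' x = lab x) \<and>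
    (\<forall>c. lab' (r - 1, c) = None \<longleftrightarrow> c \<notin> row B (r - 1) - park cs (row B (r - 1))) \<and>
    (\<forall>t. {c. \<exists>l\<ge>t. lab' (r - 1, c) = Some l} =
       row B (r - 1) - park (filter (\<lambda>c. t \<le> lbl c) cs) (row B (r - 1))) \<and>
    (\<forall>c l. lab' (r - 1, c) = Some l \<longrightarrow> r \<le> l \<and> l \<le> L) \<and>
    m' = m + (\<Sum>t\<in>{r..L}. wraps (filter (\<lambda>c. t \<le> lbl c) cs) (row B (r - 1)))"
  using S(2) srt rng res
proof (induction cs arbitrary: lab' m' rule: rev_induct)
  case Nil
  then show ?case using none by auto
next
  case (snoc c cs)
  let ?S = "row B (r - 1)"
  obtain lab1 m1 where st1: "fold (fm_pair B r) cs (lab, m) = (lab1, m1)" by fastforce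
  have srt1: "sorted_wrt (\<lambda>a b. lbl b \<le> lbl a) cs" and low: "\<And>x. x \<in> set cs \<Longrightarrow> lbl c \<le> lbl x"
    using snoc.prems(2) by (auto simp: sorted_wrt_append)
  have "length cs \<le> card ?S" "\<And>c. c \<in> set cs \<Longrightarrow> r \<le> lbl c \<and> lbl c \<le> L"
    using snoc.prems(1,3) by auto
  note IH0 = snoc.IH[OF this(1) srt1 this(2) st1]
  have IH: "\<And>x. fst x \<noteq> r - 1 \<Longrightarrow> lab1 x = lab x"
    "\<And>c. lab1 (r - 1, c) = None \<longleftrightarrow> c \<notin> ?S - park cs ?S"
    "\<And>t. {c. \<exists>l\<ge>t. lab1 (r - 1, c) = Some l} = ?S - park (filter (\<lambda>c. t \<le> lbl c) cs) ?S"
    "\<And>c l. lab1 (r - 1, c) = Some l \<Longrightarrow> r \<le> l \<and> l \<le> L"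
    "m1 = m + (\<Sum>t\<in>{r..L}. wraps (filter (\<lambda>c. t \<le> lbl c) cs) ?S)"
    using IH0 by blast+
  define F where "F = park cs ?S"
  define d where "d = cyc_next F c"
  define l where "l = lbl c"
  have FS: "F \<subseteq> ?S" by (simp add: F_def park_subset)
  have "card F = card ?S - length cs" using S(1) snoc.prems(1) by (simp add: F_def card_park)
  then have "F \<noteq> {}" using snoc.prems(1) by auto
  then have dF: "d \<in> F" using cyc_next_in FS S(1) by (auto simp: d_def intro: finite_subset)
  have Feq: "{x \<in> ?S. lab1 (r - 1, x) = None} = F" using IH(2) FS by (auto simp: F_def)
  have lc: "the (lab1 (r, c)) = l" using IH(1)[of "(r, c)"] r by (simp add: l_def lbl)
  have lr: "r \<le> l" "l \<le> L" using snoc.prems(3)[of c] by (auto simp: l_def)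
  have "fold (fm_pair B r) (cs @ [c]) (lab, m) = fm_pair B r c (lab1, m1)" by (simp add: st1)
  also have "\<dots> = (lab1((r - 1, d) := Some l), m1 + (if d < c then l + 1 - r else 0))"
    using Feq lc by (simp add: fm_pair_def Let_def d_def)
  finally have new: "lab' = lab1((r - 1, d) := Some l)" "m' = m1 + (if d < c then l + 1 - r else 0)"
    using snoc.prems(4) by auto
  have P: "park (cs @ [c]) ?S = F - {d}" by (simp add: park_append F_def d_def)
  \<comment> \<open>Labels decrease along the processing order, so once the new ball reaches
    threshold \<open>t\<close>, all earlier balls do and the filter keeps everything.\<close>
  have full: "filter (\<lambda>c. t \<le> lbl c) cs = cs" if "t \<le> l" for t
    using low that by (auto simp: l_def intro!: filter_True intro: order_trans)
  show ?case
  proof (intro conjI allI impI)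
    fix x :: "nat \<times> nat"
    assume "fst x \<noteq> r - 1"
    then show "lab' x = lab x" using IH(1) new by auto
  next
    fix x
    show "lab' (r - 1, x) = None \<longleftrightarrow> x \<notin> ?S - park (cs @ [c]) ?S"
      unfolding P using IH(2)[of x] new dF FS by (auto simp: F_def)
  next
    fix t
    show "{x. \<exists>l\<ge>t. lab' (r - 1, x) = Some l} = ?S - park (filter (\<lambda>c. t \<le> lbl c) (cs @ [c])) ?S"
    proof (cases "t \<le> l")
      case True
      have "{x. \<exists>l\<ge>t. lab' (r - 1, x) = Some l} = insert d {x. \<exists>l\<ge>t. lab1 (r - 1, x) = Some l}"
        using new True by auto
      also have "\<dots> = insert d (?S - F)" using IH(3)[of t] full[OF True] by (simp add: F_def)
      also have "\<dots> = ?S - park (cs @ [c]) ?S" unfolding P using dF FS by auto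
      finally show ?thesis using True full[OF True] by (simp add: l_def)
    next
      case False
      have "lab1 (r - 1, d) = None" using IH(2)[of d] dF by (simp add: F_def)
      then have "{x. \<exists>l\<ge>t. lab' (r - 1, x) = Some l} = {x. \<exists>l\<ge>t. lab1 (r - 1, x) = Some l}"
        using new False by auto
      then show ?thesis using IH(3)[of t] False by (simp add: l_def)
    qed
  next
    fix x k
    assume "lab' (r - 1, x) = Some k"
    then show "r \<le> k" "k \<le> L" using IH(4)[of x k] new lr by (auto split: if_splits)
  next
    have "wraps (filter (\<lambda>c. t \<le> lbl c) (cs @ [c])) ?S
      = wraps (filter (\<lambda>c. t \<le> lbl c) cs) ?S + (if t \<le> l then of_bool (d < c) else 0)" for t
      using full[of t] by (simp add: wraps_append F_def d_def l_def)
    then have "(\<Sum>t\<in>{r..L}. wraps (filter (\<lambda>c. t \<le> lbl c) (cs @ [c])) ?S)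
      = (\<Sum>t\<in>{r..L}. wraps (filter (\<lambda>c. t \<le> lbl c) cs) ?S) + (\<Sum>t\<in>{r..L}. if t \<le> l then of_bool (d < c) else 0)"
      by (simp add: sum.distrib)
    also have "(\<Sum>t\<in>{r..L}. if t \<le> l then of_bool (d < c) else 0) = (\<Sum>t\<in>{r..l}. of_bool (d < c) :: nat)"
      using lr by (intro sum.mono_neutral_cong_right) auto
    finally show "m' = m + (\<Sum>t\<in>{r..L}. wraps (filter (\<lambda>c. t \<le> lbl c) (cs @ [c])) ?S)"
      using IH(5) new by simp
  qed
qed

text \<open>The state just before row \<open>r\<close> is processed: the row carries only labels
  inherited from above, all larger than \<open>r\<close>, so thresholds start at
  \<open>Suc r\<close>, and the accumulated value covers the pairings that start in rows above
  \<open>r\<close>.\<close>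

definition fm_inv :: "nat set list \<Rightarrow> nat \<Rightarrow> fm_state \<Rightarrow> bool" where
  "fm_inv B r st \<longleftrightarrow>
     (\<forall>x. fst x < r \<longrightarrow> fst st x = None) \<and>
     (\<forall>c l. fst st (r, c) = Some l \<longrightarrow> r < l \<and> l \<le> length B) \<and>
     (\<forall>t\<in>{r<..length B}. {c. \<exists>l\<ge>t. fst st (r, c) = Some l} = landing (rows B) t r) \<and>
     snd st = (\<Sum>q\<in>{Suc r..length B}. \<Sum>t\<in>{q..length B}. nwraps (landing (rows B) t q) (rows B (q - 1)))"

lemma fm_row_step:
  assumes st: "stack (rows B)" and inv: "fm_inv B r s" and r: "2 \<le> r" "r \<le> length B"
  shows "fm_inv B (r - 1) (fm_row B r s)"
proof -
  obtain lab m where s: "s = (lab, m)" by fastforce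
  let ?L = "length B"
  have rw: "rows B r = row B r" "rows B (r - 1) = row B (r - 1)" using r by (auto simp: rows_def)
  have fin: "finite (row B r)" "finite (row B (r - 1))"
    using stackD(1)[OF st, of r] stackD(1)[OF st, of "r - 1"] r rw by auto
  have card: "card (row B r) \<le> card (row B (r - 1))"
    using stackD(2)[OF st, of "r - 1"] r rw by (auto simp: Suc_diff_Suc)
  note I = inv[unfolded fm_inv_def s, simplified]
  define lab1 where "lab1 = (\<lambda>(r', j). if r' = r \<and> j \<in> row B r \<and> lab (r', j) = None
                        then Some r else lab (r', j))"
  define lbl where "lbl = (\<lambda>c. the (lab1 (r, c)))"
  \<comment> \<open>An inherited label is at least \<open>Suc r\<close>, so its column lies in a
    landing set and thus holds a ball.\<close>
  have lab_row: "c \<in> row B r" if "lab (r, c) = Some l" for c l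
  proof -
    have "c \<in> landing (rows B) (Suc r) r" if "Suc r \<le> ?L"
      using I \<open>lab (r, c) = Some l\<close> that by (force simp: set_eq_iff)
    moreover have "Suc r \<le> ?L" using I that by fastforce
    ultimately show ?thesis using landing_subset[of "rows B"] rw by blast
  qed
  have lab1_some: "lab1 (r, c) = Some (lbl c)" "r \<le> lbl c" "lbl c \<le> ?L" if "c \<in> row B r" for c
  proof -
    show "lab1 (r, c) = Some (lbl c)" using that by (auto simp: lbl_def lab1_def)
    have "lbl c = r \<or> lab (r, c) = Some (lbl c)" using that by (auto simp: lbl_def lab1_def)
    then show "r \<le> lbl c" "lbl c \<le> ?L" using I r by fastforce+
  qed
  have lab1_in: "c \<in> row B r" if "lab1 (r, c) = Some l" for c l
    using that lab_row by (auto simp: lab1_def split: if_splits)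
  define order where "order = concat (map (\<lambda>l. filter (\<lambda>j. lab1 (r, j) = Some l)
                    (sorted_list_of_set (row B r))) (rev [r..<?L + 1]))"
  have fmrow: "fm_row B r s = fold (fm_pair B r) order (lab1, m)"
    by (simp add: fm_row_def s Let_def order_def lab1_def cong: if_cong)
  have set_order: "set order = row B r"
    using lab1_some fin by (auto simp: order_def less_Suc_eq_le simp del: upt_Suc)
  \<comment> \<open>Generalised to an arbitrary upper end \<open>k\<close>, so that raising
    \<open>k\<close> prepends one block of equal labels.\<close>
  have "sorted_wrt (\<lambda>a b. lbl b \<le> lbl a) (concat (map (\<lambda>l. filter (\<lambda>j. lab1 (r, j) = Some l)
                    (sorted_list_of_set (row B r))) (rev [r..<k])))
    \<and> distinct (concat (map (\<lambda>l. filter (\<lambda>j. lab1 (r, j) = Some l)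
                    (sorted_list_of_set (row B r))) (rev [r..<k])))" if "r \<le> k" for k
    using that
  proof (induction k rule: dec_induct)
    case (step k)
    have "sorted_wrt (\<lambda>a b. lbl b \<le> lbl a) (filter (\<lambda>j. lab1 (r, j) = Some k) (sorted_list_of_set (row B r)))"
      by (rule sorted_wrt_mono_rel[of _ "\<lambda>a b. True"]) (auto simp: lbl_def sorted_wrt_iff_nth_less)
    then show ?case using step by (auto simp: sorted_wrt_append lbl_def)
  qed simp
  then have srt: "sorted_wrt (\<lambda>a b. lbl b \<le> lbl a) order" and dist: "distinct order"
    using r by (auto simp: order_def simp del: upt_Suc)
  have len: "length order \<le> card (row B (r - 1))"
    using card set_order dist by (metis distinct_card)
  obtain lab' m' where res: "fold (fm_pair B r) order (lab1, m) = (lab', m')" by fastforce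
  have "lab1 (r - 1, c) = None" for c
    using I r by (auto simp: lab1_def)
  moreover have "r \<le> lbl c \<and> lbl c \<le> ?L" if "c \<in> set order" for c
    using lab1_some(2,3) set_order that by blast
  ultimately have F0: "(\<forall>x. fst x \<noteq> r - 1 \<longrightarrow> lab' x = lab1 x) \<and>
    (\<forall>c. lab' (r - 1, c) = None \<longleftrightarrow> c \<notin> row B (r - 1) - park order (row B (r - 1))) \<and>
    (\<forall>t. {c. \<exists>l\<ge>t. lab' (r - 1, c) = Some l} =
       row B (r - 1) - park (filter (\<lambda>c. t \<le> lbl c) order) (row B (r - 1))) \<and>
    (\<forall>c l. lab' (r - 1, c) = Some l \<longrightarrow> r \<le> l \<and> l \<le> ?L) \<and>
    m' = m + (\<Sum>t\<in>{r..?L}. wraps (filter (\<lambda>c. t \<le> lbl c) order) (row B (r - 1)))"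
    using lbl_def srt res by (intro fold_fm_pair[OF fin(2) len r(1), where lab = lab1]) simp_all
  then have F: "\<And>x. fst x \<noteq> r - 1 \<Longrightarrow> lab' x = lab1 x"
    "\<And>t. {c. \<exists>l\<ge>t. lab' (r - 1, c) = Some l} =
       row B (r - 1) - park (filter (\<lambda>c. t \<le> lbl c) order) (row B (r - 1))"
    "\<And>c l. lab' (r - 1, c) = Some l \<Longrightarrow> r \<le> l \<and> l \<le> ?L"
    "m' = m + (\<Sum>t\<in>{r..?L}. wraps (filter (\<lambda>c. t \<le> lbl c) order) (row B (r - 1)))"
    by blast+
  \<comment> \<open>At \<open>t = r\<close> every ball counts, since the unlabelled ones have just
    received \<open>r\<close>; for larger thresholds these new labels are too small and the
    invariant applies.\<close>
  have land: "set (filter (\<lambda>c. t \<le> lbl c) order) = landing (rows B) t r" if "t \<in> {r..?L}" for t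
  proof (cases "t = r")
    case True
    then have "landing (rows B) t r = row B r" using rw by (subst landing.simps) simp
    then show ?thesis using True set_order lab1_some by auto
  next
    case False
    then have "landing (rows B) t r = {c. \<exists>l\<ge>t. lab (r, c) = Some l}" using I that by auto
    also have "\<dots> = {c \<in> row B r. t \<le> lbl c}"
      using lab_row that False by (auto simp: lbl_def lab1_def)
    finally show ?thesis using set_order by auto
  qed
  have len_f: "length (filter P order) \<le> card (row B (r - 1))" for P
    using len length_filter_le order_trans by blast
  have park: "row B (r - 1) - park (filter (\<lambda>c. t \<le> lbl c) order) (row B (r - 1)) = landing (rows B) t (r - 1)"
    "wraps (filter (\<lambda>c. t \<le> lbl c) order) (row B (r - 1)) = nwraps (landing (rows B) t r) (row B (r - 1))"
    if "t \<in> {r..?L}" for t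
  proof -
    note O = occ_nwraps_list[OF fin(2) len_f distinct_filter[OF dist] land[OF that]]
    show "wraps (filter (\<lambda>c. t \<le> lbl c) order) (row B (r - 1)) = nwraps (landing (rows B) t r) (row B (r - 1))"
      using O(2) by simp
    have "landing (rows B) t (r - 1) = occ (landing (rows B) t r) (row B (r - 1))"
      using that r rw by (subst landing.simps) auto
    then show "row B (r - 1) - park (filter (\<lambda>c. t \<le> lbl c) order) (row B (r - 1)) = landing (rows B) t (r - 1)"
      using O(1) by simp
  qed
  show ?thesis
    unfolding fm_inv_def fmrow res
  proof (intro conjI allI impI ballI)
    fix x :: "nat \<times> nat"
    assume "fst x < r - 1"
    then show "fst (lab', m') x = None" using F(1)[of x] I by (cases x) (auto simp: lab1_def)
  next
    fix c l
    assume "fst (lab', m') (r - 1, c) = Some l"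
    then show "r - 1 < l" "l \<le> ?L" using F(3)[of c l] r by auto
  next
    fix t
    assume "t \<in> {r - 1<..?L}"
    then have "t \<in> {r..?L}" by auto
    then show "{c. \<exists>l\<ge>t. fst (lab', m') (r - 1, c) = Some l} = landing (rows B) t (r - 1)"
      using F(2)[of t] park(1)[of t] by simp
  next
    have "{r..?L} = insert r {Suc r..?L}" using r by auto
    then have "(\<Sum>q\<in>{Suc (r - 1)..?L}. \<Sum>t\<in>{q..?L}. nwraps (landing (rows B) t q) (rows B (q - 1)))
      = (\<Sum>t\<in>{r..?L}. nwraps (landing (rows B) t r) (rows B (r - 1))) + m"
      using I r by simp
    also have "\<dots> = m'" using F(4) park(2) rw by simp
    finally show "snd (lab', m') = (\<Sum>q\<in>{Suc (r - 1)..?L}. \<Sum>t\<in>{q..?L}. nwraps (landing (rows B) t q) (rows B (q - 1)))"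
      by simp
  qed
qed

lemma maj_layered:
  assumes "stack (rows B)"
  shows "maj B = layered (rows B) (length B)"
proof (cases "length B = 0")
  case True
  then show ?thesis by (simp add: maj_def layered_def)
next
  case False
  let ?L = "length B"
  have "fm_inv B n (fold (fm_row B) (rev [Suc n..<?L + 1]) (\<lambda>_. None, 0))"
    if "1 \<le> n" "n \<le> ?L" for n
    using that(2,1)
  proof (induction n rule: inc_induct)
    case base
    then show ?case by (simp add: fm_inv_def)
  next
    case (step n)
    have "rev [Suc n..<?L + 1] = rev [Suc (Suc n)..<?L + 1] @ [Suc n]"
      using step.hyps by (subst upt_rec) simp
    then show ?case
      using fm_row_step[OF assms step.IH] step.hyps step.prems by simp
  qed
  from this[of 1] False have "fm_inv B 1 (fold (fm_row B) (rev [2..<?L + 1]) (\<lambda>_. None, 0))"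
    by (simp add: Suc_le_eq numeral_2_eq_2 del: upt_Suc)
  then show ?thesis
    by (simp add: maj_def layered_landing fm_inv_def numeral_2_eq_2 del: upt_Suc)
qed

section \<open>Charge\<close>

definition pos :: "nat list \<Rightarrow> nat \<Rightarrow> nat set" where
  "pos w a = {j. j < length w \<and> w ! j = a}"

lemma finite_pos [simp]: "finite (pos w a)"
  by (simp add: pos_def)

lemma first_cyc_eq: "first_cyc w s a = cyc_next (pos w a) s"
  by (simp add: first_cyc_def cyc_next_def pos_def Let_def)

lemma fall_empty [simp]: "fall R i {} = 0"
  by (induction i) (simp_all add: nwraps_def occ_def)

lemma layered_extend:
  assumes "k \<le> L" "\<And>r. k < r \<Longrightarrow> r \<le> L \<Longrightarrow> R r = {}"
  shows "layered R L = layered R k"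
  unfolding layered_def
  using assms by (intro sum.mono_neutral_right) auto

text \<open>By \<open>occ_remove\<close> the ball of the chain may go first in every row. It then
  lands on the next member of the chain, and the other balls see exactly the rows \<open>R'\<close>
  with the chain deleted.\<close>

lemma fall_remove_chain:
  assumes "stack R" "C \<subseteq> R (Suc i)" "p (Suc i) \<in> C"
    "\<And>a. a \<in> {1..i} \<Longrightarrow> p a = cyc_next (R a) (p (Suc a))"
    "\<And>a. a \<in> {1..i} \<Longrightarrow> R' a = R a - {p a}"
  shows "fall R i C = (\<Sum>a\<in>{1..i}. of_bool (p a < p (Suc a))) + fall R' i (C - {p (Suc i)})"
  using assms
proof (induction i arbitrary: C)
  case (Suc i)
  let ?S = "R (Suc i)" and ?c = "p (Suc (Suc i))" and ?d = "p (Suc i)"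
  have fS: "finite ?S" "finite C"
    using stackD(1)[OF Suc.prems(1)] Suc.prems(2) by (auto intro: finite_subset)
  have "card C \<le> card (R (Suc (Suc i)))"
    using Suc.prems(2) stackD(1)[OF Suc.prems(1)] by (simp add: card_mono)
  also have "\<dots> \<le> card ?S" using stackD(2)[OF Suc.prems(1), of "Suc i"] by simp
  finally have cC: "card C \<le> card ?S" .
  have d: "cyc_next ?S ?c = ?d" using Suc.prems(4)[of "Suc i"] by simp
  note rem = occ_remove[OF fS cC Suc.prems(3), unfolded d]
  have X: "occ (C - {?c}) (?S - {?d}) \<subseteq> ?S - {?d}" by (rule occ_subset)
  have "?S \<noteq> {}" using cC Suc.prems(3) fS by (auto simp: card_eq_0_iff)
  then have dS: "?d \<in> ?S" using cyc_next_in[OF fS(1)] d by metis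
  have "fall R i (occ C ?S) = (\<Sum>a\<in>{1..i}. of_bool (p a < p (Suc a))) + fall R' i (occ C ?S - {?d})"
    using Suc.prems(4,5) rem(1) by (intro Suc.IH[OF Suc.prems(1) occ_subset]) auto
  also have "occ C ?S - {?d} = occ (C - {?c}) (R' (Suc i))"
    using rem(1) X Suc.prems(5)[of "Suc i"] by auto
  finally show ?case
    using rem(2) Suc.prems(5)[of "Suc i"] by simp
qed simp

text \<open>Source of the charge weight: the step from letter \<open>Suc a\<close> to
  \<open>a\<close> is made under each \<open>l\<close> with \<open>a \<le> l < k\<close>, that is
  \<open>k - a\<close> times.\<close>

lemma sum_triangle:
  fixes x :: "nat \<Rightarrow> nat"
  shows "(\<Sum>l<k. \<Sum>a\<in>{1..l}. x a) = (\<Sum>a\<in>{1..<k}. (k - a) * x a)"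
proof (induction k)
  case (Suc k)
  have "(\<Sum>a\<in>{1..<Suc k}. (Suc k - a) * x a) = (\<Sum>a\<in>{1..k}. (k - a) * x a + x a)"
    by (rule sum.cong) (auto simp: Suc_diff_le)
  also have "\<dots> = (\<Sum>a\<in>{1..k}. (k - a) * x a) + (\<Sum>a\<in>{1..k}. x a)"
    by (rule sum.distrib)
  also have "(\<Sum>a\<in>{1..k}. (k - a) * x a) = (\<Sum>a\<in>{1..<k}. (k - a) * x a)"
    by (rule sum.mono_neutral_right) auto
  finally show ?case using Suc by (simp only: sum.lessThan_Suc)
qed simp

lemma layered_remove_chain:
  assumes "stack R"
    "\<And>a. a \<in> {1..k} \<Longrightarrow> p a = cyc_next (R a) (p (Suc a)) \<and> p a \<in> R a \<and> R' a = R a - {p a}"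
  shows "layered R k = (\<Sum>a\<in>{1..<k}. (k - a) * of_bool (p a < p (Suc a))) + layered R' k"
proof -
  have "layered R k = (\<Sum>l<k. (\<Sum>a\<in>{1..l}. of_bool (p a < p (Suc a))) + fall R' l (R' (Suc l)))"
    unfolding layered_def
  proof (intro sum.cong refl)
    fix l
    assume "l \<in> {..<k}"
    then have "Suc l \<in> {1..k}" by simp
    from assms(2)[OF this] have l: "R' (Suc l) = R (Suc l) - {p (Suc l)}" "p (Suc l) \<in> R (Suc l)"
      by blast+
    show "fall R l (R (Suc l)) = (\<Sum>a\<in>{1..l}. of_bool (p a < p (Suc a))) + fall R' l (R' (Suc l))"
      unfolding l(1)
    proof (rule fall_remove_chain[where p = p, OF assms(1) subset_refl])
      show "p (Suc l) \<in> R (Suc l)" by fact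
    next
      fix a
      assume "a \<in> {1..l}"
      then have "a \<in> {1..k}" using \<open>l \<in> {..<k}\<close> by simp
      from assms(2)[OF this] show "p a = cyc_next (R a) (p (Suc a))" "R' a = R a - {p a}" by blast+
    qed
  qed
  then show ?thesis by (simp only: sum.distrib sum_triangle layered_def)
qed

text \<open>Indexes the extracted subword by its letters. The value at \<open>Suc k\<close> is no
  letter but the start of the scan, so that the choice of the largest letter fits the same
  recursion.\<close>

lemma chain_pos_path:
  "\<exists>p. p (Suc k) = c \<and> (\<forall>a\<in>{1..k}. p a = cyc_next (pos w a) (p (Suc a))) \<and>
     set (chain_pos w k c) = p ` {1..k}"
proof (induction k arbitrary: c)
  case 0
  show ?case by (rule exI[of _ "\<lambda>_. c"]) simp
next
  case (Suc k)
  define q where "q = cyc_next (pos w (Suc k)) c"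
  from Suc.IH[of q] obtain p where p: "p (Suc k) = q"
    "\<forall>a\<in>{1..k}. p a = cyc_next (pos w a) (p (Suc a))" "set (chain_pos w k q) = p ` {1..k}"
    by blast
  let ?p = "p(Suc (Suc k) := c)"
  have *: "{1..Suc k} = insert (Suc k) {1..k}" by auto
  have "\<forall>a\<in>{1..Suc k}. ?p a = cyc_next (pos w a) (?p (Suc a))"
    using p by (auto simp: * q_def)
  moreover have "set (chain_pos w (Suc k) c) = insert q (p ` {1..k})"
    using p(3) by (simp add: Let_def first_cyc_eq q_def)
  moreover have "?p ` {1..Suc k} = insert q (p ` {1..k})"
    using p(1) unfolding * by auto
  ultimately show ?case by (intro exI[of _ ?p]) simp
qed

text \<open>Each letter of \<open>{1..k}\<close> occurs once on the path, at \<open>p a\<close>; and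
  letter \<open>a\<close> standing left of \<open>Suc a\<close> is precisely a wrap in the search
  for \<open>a\<close>.\<close>

lemma perm_charge_path:
  assumes "\<And>a. a \<in> {1..k} \<Longrightarrow> w ! p a = a"
  shows "perm_charge (map ((!) w) (sorted_list_of_set (p ` {1..k})))
    = (\<Sum>a\<in>{1..<k}. (k - a) * of_bool (p a < p (Suc a)))"
proof -
  define xs where "xs = sorted_list_of_set (p ` {1..k})"
  have inj: "inj_on p {1..k}" by (metis assms inj_onI)
  have len: "length xs = k" using card_image[OF inj] by (simp add: xs_def)
  have set: "set xs = p ` {1..k}" by (simp add: xs_def)
  have srt: "sorted_wrt (<) xs" by (simp add: xs_def)
  have at: "xs ! a = p i" if "a < k" "w ! (xs ! a) = i" for a i
  proof -
    have "xs ! a \<in> p ` {1..k}" using that len set nth_mem by metis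
    then show ?thesis using assms that by auto
  qed
  have "(\<exists>a b. a < b \<and> b < k \<and> map ((!) w) xs ! a = i \<and> map ((!) w) xs ! b = Suc i) \<longleftrightarrow> p i < p (Suc i)"
    if i: "i \<in> {1..<k}" for i
  proof
    assume "\<exists>a b. a < b \<and> b < k \<and> map ((!) w) xs ! a = i \<and> map ((!) w) xs ! b = Suc i"
    then obtain a b where ab: "a < b" "b < k" "w ! (xs ! a) = i" "w ! (xs ! b) = Suc i"
      using len by auto
    then have "xs ! a < xs ! b" using srt len by (simp add: sorted_wrt_nth_less)
    then show "p i < p (Suc i)" using at[of a i] at[of b "Suc i"] ab by simp
  next
    assume less: "p i < p (Suc i)"
    have "p i \<in> set xs" "p (Suc i) \<in> set xs" using i set by auto
    then obtain a b where ab: "a < k" "b < k" "xs ! a = p i" "xs ! b = p (Suc i)"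
      using len by (metis in_set_conv_nth)
    have "a < b"
    proof (rule ccontr)
      assume "\<not> a < b"
      then have "xs ! b \<le> xs ! a"
        using srt ab len by (metis le_eq_less_or_eq linorder_neqE_nat sorted_wrt_nth_less)
      then show False using ab less by simp
    qed
    then show "\<exists>a b. a < b \<and> b < k \<and> map ((!) w) xs ! a = i \<and> map ((!) w) xs ! b = Suc i"
      using ab assms i len by (intro exI[of _ a] exI[of _ b]) auto
  qed
  then have "perm_charge (map ((!) w) xs) = (\<Sum>i\<in>{1..<k}. if p i < p (Suc i) then k - i else 0)"
    unfolding perm_charge_def Let_def length_map len by (intro sum.cong) simp_all
  also have "\<dots> = (\<Sum>a\<in>{1..<k}. (k - a) * of_bool (p a < p (Suc a)))"
    by (intro sum.cong) auto
  finally show ?thesis by (simp add: xs_def)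
qed

lemma concat_if_filter: "concat (map (\<lambda>j. if Q j then [g j] else []) xs) = map g (filter Q xs)"
  by (induction xs) auto

lemma pos_filter:
  fixes w :: "nat list" and P :: "nat set"
  defines "idx \<equiv> filter (\<lambda>j. j \<notin> P) [0..<length w]"
  shows "(!) idx ` pos (map ((!) w) idx) a = pos w a - P" "strict_mono_on {..<length idx} ((!) idx)"
proof -
  have "sorted_wrt (<) idx" unfolding idx_def by (rule sorted_wrt_filter) simp
  then show "strict_mono_on {..<length idx} ((!) idx)"
    by (auto simp: monotone_on_def sorted_wrt_nth_less)
  have "pos w a - P = {j \<in> set idx. w ! j = a}" by (auto simp: idx_def pos_def)
  also have "\<dots> = (!) idx ` {i. i < length idx \<and> w ! (idx ! i) = a}"
    by (auto simp: in_set_conv_nth)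
  also have "{i. i < length idx \<and> w ! (idx ! i) = a} = pos (map ((!) w) idx) a"
    by (auto simp: pos_def)
  finally show "(!) idx ` pos (map ((!) w) idx) a = pos w a - P" by simp
qed

lemma charge_aux_layered:
  assumes "length w \<le> f" "stack (pos w)" "set w \<subseteq> {1..L}"
  shows "charge_aux f w = layered (pos w) L"
  using assms
proof (induction f arbitrary: w)
  case 0
  then have "pos w a = {}" for a by (simp add: pos_def)
  then show ?case by (simp add: layered_def)
next
  case (Suc f)
  show ?case
  proof (cases "w = []")
    case True
    then have "pos w a = {}" for a by (simp add: pos_def)
    then show ?thesis using True by (simp add: layered_def)
  next
    case False
    define k where "k = Max (set w)"
    have kin: "k \<in> set w" using False by (simp add: k_def)
    have kmax: "a \<le> k" if "a \<in> set w" for a using that by (simp add: k_def)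
    have k: "1 \<le> k" "k \<le> L" using kin Suc.prems(3) by auto
    obtain p where p: "\<And>a. a \<in> {1..k} \<Longrightarrow> p a = cyc_next (pos w a) (p (Suc a))"
      "set (chain_pos w k 0) = p ` {1..k}"
      using chain_pos_path[of k 0 w] by blast
    define P where "P = p ` {1..k}"
    have "pos w k \<noteq> {}" using kin by (auto simp: pos_def in_set_conv_nth)
    then have ck: "0 < card (pos w k)" by (simp add: card_gt_0_iff)
    \<comment> \<open>Multiplicities only grow towards smaller letters, so with \<open>k\<close>
      every letter below it occurs and the chain never fails.\<close>
    have "0 < card (pos w a)" if "a \<in> {1..k}" for a
    proof -
      have "a \<le> k" "1 \<le> a" using that by auto
      then show ?thesis
      proof (induction a rule: inc_induct)
        case base
        show ?case by (rule ck)
      next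
        case (step n)
        then show ?case using stackD(2)[OF Suc.prems(2), of n] by simp
      qed
    qed
    then have ne: "pos w a \<noteq> {}" if "a \<in> {1..k}" for a using that by fastforce
    have pin: "p a \<in> pos w a" if "a \<in> {1..k}" for a
      using p(1)[OF that] cyc_next_in[OF finite_pos ne[OF that]] by simp
    have diff: "pos w a - P = pos w a - {p a}" if "a \<in> {1..k}" for a
      using pin that by (auto simp: P_def pos_def)
    have empty: "pos w a = {}" if "k < a" for a
      using kmax that by (force simp: pos_def dest: nth_mem)
    define idx where "idx = filter (\<lambda>j. j \<notin> P) [0..<length w]"
    define w' where "w' = map ((!) w) idx"
    note idx = pos_filter[of P w, folded idx_def, folded w'_def]
    have sub: "pos w' a \<subseteq> {..<length idx}" for a by (auto simp: pos_def w'_def)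
    have sm: "strict_mono_on (pos w' a) ((!) idx)" for a
      using idx(2) sub by (rule monotone_on_subset)
    have "card (pos w' a) = card (pos w a - P)" for a
      using card_image[OF strict_mono_on_imp_inj_on[OF sm]] idx(1) by metis
    \<comment> \<open>Every letter up to \<open>k\<close> loses one occurrence and none exists
      beyond, so the content stays a partition.\<close>
    then have card': "card (pos w' a) = (if a \<in> {1..k} then card (pos w a) - 1 else 0)" if "1 \<le> a" for a
      using diff[of a] pin[of a] empty[of a] that by auto
    have "stack (pos w')"
      using Suc.prems(2) card' ck by (auto simp: stack_def intro: diff_le_mono)
    \<comment> \<open>Deleting letters renumbers positions; \<open>idx\<close> maps the new numbers
      back monotonically.\<close>
    have "layered (\<lambda>a. pos w a - P) L = layered (pos w') L"
    proof (rule layered_transport[where g = "\<lambda>_. (!) idx"])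
      show "stack (pos w')" by fact
      show "strict_mono_on (pos w' r) ((!) idx) \<and> pos w r - P = (!) idx ` pos w' r" for r
        using sm idx(1) by simp
      show "c \<le> s \<longleftrightarrow> idx ! c \<le> idx ! s" if "c \<in> pos w' (Suc r)" "s \<in> pos w' r" for r c s
      proof -
        have "c < length idx" "s < length idx" using that sub by auto
        then show ?thesis using strict_mono_on_less_eq[OF idx(2), of c s] by simp
      qed
    qed
    also have "\<dots> = charge_aux f w'"
    proof (rule Suc.IH[symmetric])
      show "stack (pos w')" by fact
      have "set idx \<subseteq> {..<length w}" by (auto simp: idx_def)
      then show "set w' \<subseteq> {1..L}" using Suc.prems(3) by (auto simp: w'_def subset_iff)
      have "p k < length w" "p k \<in> P" using pin[of k] k by (auto simp: pos_def P_def)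
      then have "length idx < length [0..<length w]"
        unfolding idx_def by (intro length_filter_less[of "p k"]) auto
      then show "length w' \<le> f" using Suc.prems(1) by (simp add: w'_def)
    qed
    finally have rest: "charge_aux f w' = layered (\<lambda>a. pos w a - P) k"
      using layered_extend[OF k(2), of "\<lambda>a. pos w a - P"] empty by simp
    have "layered (pos w) L = layered (pos w) k"
      using layered_extend[OF k(2), of "pos w"] empty by simp
    also have "\<dots> = (\<Sum>a\<in>{1..<k}. (k - a) * of_bool (p a < p (Suc a))) + layered (\<lambda>a. pos w a - P) k"
      using p(1) pin diff by (intro layered_remove_chain[OF Suc.prems(2)]) simp
    also have "(\<Sum>a\<in>{1..<k}. (k - a) * of_bool (p a < p (Suc a))) = perm_charge (map ((!) w) (sorted_list_of_set P))"
      unfolding P_def using pin by (intro perm_charge_path[symmetric]) (auto simp: pos_def)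
    finally show ?thesis
      using False rest p(2)[folded P_def]
      by (simp add: Let_def concat_if_filter k_def[symmetric] w'_def idx_def)
  qed
qed

section \<open>Knuth invariance\<close>

lemma fall_cong:
  assumes "\<And>r. r \<in> {1..i} \<Longrightarrow> R r = R' r"
  shows "fall R i C = fall R' i C"
  using assms by (induction i arbitrary: C) auto

text \<open>No ball starts after \<open>s\<close> and up to \<open>t\<close>, so every ball meets
  \<open>s\<close> before \<open>t\<close> on its cyclic way and never takes \<open>t\<close> while
  \<open>s\<close> is free.\<close>

lemma park_closed:
  assumes "finite S" "s \<in> S \<longrightarrow> t \<in> S" "s < t" "\<And>c. c \<in> set cs \<Longrightarrow> c \<le> s \<or> t < c"
  shows "s \<in> park cs S \<longrightarrow> t \<in> park cs S"
  using assms
proof (induction cs arbitrary: S)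
  case (Cons c cs)
  let ?d = "cyc_next S c"
  have "?d \<noteq> t" if "s \<in> S"
  proof
    assume d: "?d = t"
    have "S \<noteq> {}" using that by auto
    then have "c \<le> t \<and> (c \<le> s \<longrightarrow> t \<le> s) \<or> t \<le> s"
      using cyc_next_cases[OF Cons.prems(1), of c] that unfolding d by auto
    then show False using Cons.prems(3) Cons.prems(4)[of c] by auto
  qed
  then have "s \<in> S - {?d} \<longrightarrow> t \<in> S - {?d}" using Cons.prems(2) by auto
  moreover have "finite (S - {?d})" using Cons.prems(1) by simp
  ultimately have "s \<in> park cs (S - {?d}) \<longrightarrow> t \<in> park cs (S - {?d})"
    using Cons.prems(3,4) by (intro Cons.IH) auto
  then show ?case by simp
qed simp

lemma occ_closed:
  assumes "finite S" "finite C" "s \<in> S" "t \<in> S" "s < t" "\<And>c. c \<in> C \<Longrightarrow> c \<le> s \<or> t < c" "t \<in> occ C S"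
  shows "s \<in> occ C S"
proof -
  have "s \<in> park (sorted_list_of_set C) S \<longrightarrow> t \<in> park (sorted_list_of_set C) S"
    using assms by (intro park_closed) auto
  then show ?thesis using assms by (auto simp: occ_def)
qed

lemma cyc_next_self: "finite S \<Longrightarrow> c \<in> S \<Longrightarrow> cyc_next S c = c"
  by (rule cyc_next_ahead) auto

lemma cyc_next_step:
  assumes "finite S" "c \<notin> S" "Suc c \<in> S"
  shows "cyc_next S c = Suc c"
  using assms by (intro cyc_next_ahead) (auto simp: Suc_le_eq le_less)

text \<open>A Knuth move that swaps letters \<open>i\<close> and \<open>Suc i\<close> at positions \<open>a\<close> and \<open>Suc a\<close> amounts
  to moving a ball of row \<open>Suc i\<close> from column \<open>Suc a\<close> to column \<open>a\<close>, next to a ball of row \<open>i\<close>.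
  The two alternatives of \<open>witness\<close> correspond to the two kinds of Knuth moves.\<close>
locale shift =
  fixes R :: "nat \<Rightarrow> nat set" and i a :: nat
  assumes stack: "stack R" and i: "1 \<le> i"
    and car: "Suc a \<in> R (Suc i)" "a \<notin> R (Suc i)"
    and spot: "a \<in> R i" "Suc a \<notin> R i"
    and above: "a \<notin> R (Suc (Suc i))" "Suc a \<notin> R (Suc (Suc i))"
    and below: "a \<notin> R (i - 1)" "Suc a \<notin> R (i - 1)"
    and witness: "Suc (Suc a) \<in> R i \<and> Suc (Suc a) \<notin> R (Suc i) \<or>
       0 < a \<and> a - 1 \<in> R (Suc i) \<and> a - 1 \<notin> R i"
begin

definition mv :: "nat \<Rightarrow> nat" where
  "mv c = (if c = Suc a then a else c)"

lemma inj_mv: "D \<subseteq> R (Suc i) \<Longrightarrow> inj_on mv D"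
  using car by (auto simp: inj_on_def mv_def)

lemma card_sub: "D \<subseteq> R (Suc i) \<Longrightarrow> finite D \<and> card D \<le> card (R i)"
  using stackD(1)[OF stack, of "Suc i"] stackD(2)[OF stack i] by (metis card_mono finite_subset le_SucI i order_trans)

text \<open>The witness ball in column \<open>a - 1\<close> goes first and takes the place
  \<open>a\<close>, in both configurations. Afterwards row \<open>i\<close> offers no place in
  columns \<open>a\<close> and \<open>Suc a\<close>, so a ball starting in either of them fares the
  same.\<close>

lemma fall_mv_left:
  assumes D: "D \<subseteq> R (Suc i)" "Suc a \<in> D" and w: "0 < a" "a - 1 \<in> D" "a - 1 \<notin> R i"
  shows "fall R i (mv ` D) = fall R i D"
proof -
  obtain j where j: "i = Suc j" using i by (cases i) auto
  let ?S = "R i" and ?b = "a - 1"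
  have fS: "finite ?S" using stackD(1)[OF stack i] .
  note cD = card_sub[OF D(1)]
  have nx: "cyc_next ?S ?b = a" using cyc_next_step[OF fS w(3)] w(1) spot by simp
  have im: "mv ` D - {?b} = mv ` (D - {?b})" using w(1) by (auto simp: mv_def)
  have bD: "?b \<in> mv ` D" using w by (force simp: mv_def)
  have cmD: "card (mv ` D) \<le> card ?S" "finite (mv ` D)"
    using cD card_image[OF inj_mv[OF D(1)]] by auto
  have cs: "card (D - {?b}) \<le> card (?S - {a})"
    using cD w(2) spot(1) fS by (simp add: diff_le_mono)
  have T: "occ (mv ` (D - {?b})) (id ` (?S - {a})) = id ` occ (D - {?b}) (?S - {a})"
    "nwraps (mv ` (D - {?b})) (id ` (?S - {a})) = nwraps (D - {?b}) (?S - {a})"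
  proof (rule_tac [!] occ_transport)
    show "finite (?S - {a})" "finite (?S - {a})" "finite (D - {?b})" "finite (D - {?b})" using fS cD by auto
    show "card (D - {?b}) \<le> card (?S - {a})" "card (D - {?b}) \<le> card (?S - {a})" by fact+
    show "strict_mono_on (?S - {a}) id" "strict_mono_on (?S - {a}) id" by (auto simp: monotone_on_def)
    have "D - {?b} \<subseteq> R (Suc i)" using D(1) by auto
    then show "inj_on mv (D - {?b})" "inj_on mv (D - {?b})" by (rule inj_mv)+
    show "c \<le> s \<longleftrightarrow> mv c \<le> id s" "c \<le> s \<longleftrightarrow> mv c \<le> id s" if "s \<in> ?S - {a}" for c s
      using that by (auto simp: mv_def)
  qed
  have "occ (mv ` D) ?S = occ D ?S"
    using occ_remove(1)[OF fS cmD(2,1) bD] occ_remove(1)[OF fS _ _ w(2)] cD T(1)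
    unfolding nx im by simp
  moreover have "nwraps (mv ` D) ?S = nwraps D ?S"
    using occ_remove(2)[OF fS cmD(2,1) bD] occ_remove(2)[OF fS _ _ w(2)] cD T(2)
    unfolding nx im by simp
  ultimately show ?thesis by (simp add: j)
qed

text \<open>The unmoved ball goes first to \<open>Suc (Suc a)\<close>, the moved one to
  \<open>a\<close>. No other ball starts in columns \<open>Suc a\<close> and
  \<open>Suc (Suc a)\<close>, so for the rest the remaining one of these two places plays the same
  role, which is the map \<open>g\<close>.\<close>

lemma fall_mv_right:
  assumes D: "D \<subseteq> R (Suc i)" "Suc a \<in> D" and w: "Suc (Suc a) \<in> R i" "Suc (Suc a) \<notin> R (Suc i)"
  shows "fall R i (mv ` D) = fall R i D"
proof -
  obtain j where j: "i = Suc j" using i by (cases i) auto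
  let ?S = "R i" and ?b = "Suc (Suc a)"
  have fS: "finite ?S" using stackD(1)[OF stack i] .
  note cD = card_sub[OF D(1)]
  define D0 where "D0 = D - {Suc a}"
  have aD: "a \<notin> D" using D(1) car by auto
  have mD: "mv ` D = insert a D0" using D(2) by (force simp: mv_def D0_def)
  have cmD: "card (mv ` D) \<le> card ?S" "finite (mv ` D)"
    using cD card_image[OF inj_mv[OF D(1)]] by auto
  have nx: "cyc_next ?S (Suc a) = ?b" "cyc_next ?S a = a"
    using cyc_next_step[OF fS spot(2)] w(1) cyc_next_self[OF fS spot(1)] by auto
  define g where "g = (\<lambda>s. if s = a then ?b else s)"
  define X where "X = occ D0 (?S - {?b})"
  have img: "g ` (?S - {?b}) = ?S - {a}" using w(1) spot by (force simp: g_def)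
  have T: "occ (id ` D0) (g ` (?S - {?b})) = g ` occ D0 (?S - {?b})"
    "nwraps (id ` D0) (g ` (?S - {?b})) = nwraps D0 (?S - {?b})"
  proof (rule_tac [!] occ_transport)
    show "finite (?S - {?b})" "finite (?S - {?b})" "finite D0" "finite D0" using fS cD by (auto simp: D0_def)
    show "card D0 \<le> card (?S - {?b})" "card D0 \<le> card (?S - {?b})"
      using cD D(2) w(1) fS by (simp_all add: D0_def diff_le_mono)
    show "strict_mono_on (?S - {?b}) g" "strict_mono_on (?S - {?b}) g"
      using spot(2) by (auto simp: monotone_on_def g_def Suc_lessI) (metis Suc_lessI less_antisym)+
    show "inj_on id D0" "inj_on id D0" by auto
    show "c \<le> s \<longleftrightarrow> id c \<le> g s" "c \<le> s \<longleftrightarrow> id c \<le> g s" if "c \<in> D0" "s \<in> ?S - {?b}" for c s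
    proof -
      have "c \<noteq> Suc a" "c \<noteq> ?b" using that(1) D(1) w(2) by (auto simp: D0_def)
      then show "c \<le> s \<longleftrightarrow> id c \<le> g s" "c \<le> s \<longleftrightarrow> id c \<le> g s" by (auto simp: g_def)
    qed
  qed
  have o1: "occ D ?S = insert ?b X" "nwraps D ?S = nwraps D0 (?S - {?b})"
    using occ_remove[OF fS _ _ D(2)] cD unfolding nx D0_def[symmetric] X_def by auto
  have "mv ` D - {a} = D0" using mD aD by (auto simp: D0_def)
  then have o2: "occ (mv ` D) ?S = insert a (g ` X)" "nwraps (mv ` D) ?S = nwraps D0 (?S - {?b})"
    using occ_remove[OF fS cmD(2,1), of a] mD T unfolding nx img X_def by auto
  have Xsub: "X \<subseteq> ?S - {?b}" unfolding X_def by (rule occ_subset)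
  \<comment> \<open>If the second of the two places is reached as well, both sets coincide.
    Otherwise they differ in one ball, and row \<open>i - 1\<close> has nothing in columns
    \<open>a\<close> and \<open>Suc a\<close> to separate its two positions.\<close>
  have "fall R j (insert a (g ` X)) = fall R j (insert ?b X)"
  proof (cases "a \<in> X")
    case True
    then have "insert a (g ` X) = insert ?b X" by (force simp: g_def)
    then show ?thesis by simp
  next
    case False
    define f where "f = (\<lambda>s. if s = ?b then a else s)"
    have "g ` X = X" using False by (force simp: g_def)
    moreover have "f ` insert ?b X = insert a X" using Xsub by (force simp: f_def)
    moreover have "fall R j (f ` insert ?b X) = fall R j (insert ?b X)"
    proof (rule fall_transport[where g = "\<lambda>_ s. s", OF stack])
      show "insert ?b X \<subseteq> R (Suc j)" using Xsub w(1) j by auto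
      show "inj_on f (insert ?b X)" using False by (auto simp: inj_on_def f_def)
      show "c \<le> s \<longleftrightarrow> f c \<le> s" if "s \<in> R j" for c s
      proof -
        have "s \<noteq> a" "s \<noteq> Suc a" using that below j by auto
        then show ?thesis by (auto simp: f_def)
      qed
    qed (auto simp: monotone_on_def)
    ultimately show ?thesis by simp
  qed
  then show ?thesis using o1 o2 by (simp add: j)
qed

text \<open>The left witness helps only if it is itself among the falling balls, hence the closure
  condition; for reached sets \<open>occ_closed\<close> supplies it.\<close>

lemma fall_mv:
  assumes "D \<subseteq> R (Suc i)" "0 < a \<Longrightarrow> a - 1 \<in> R (Suc i) \<Longrightarrow> Suc a \<in> D \<Longrightarrow> a - 1 \<in> D"
  shows "fall R i (mv ` D) = fall R i D"
proof (cases "Suc a \<in> D")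
  case True
  then show ?thesis
    using witness fall_mv_left[OF assms(1) True] fall_mv_right[OF assms(1) True] assms(2) by blast
next
  case False
  then have "mv ` D = D" by (force simp: mv_def)
  then show ?thesis by simp
qed

definition R2 :: "nat \<Rightarrow> nat set" where
  "R2 = R(Suc i := insert a (R (Suc i) - {Suc a}))"

lemma R2_simps: "R2 (Suc i) = mv ` R (Suc i)" "r \<noteq> Suc i \<Longrightarrow> R2 r = R r"
  using car by (force simp: R2_def mv_def)+

text \<open>No ball of row \<open>Suc (Suc i)\<close> sits at \<open>a\<close> or
  \<open>Suc a\<close>, so the set reached in row \<open>Suc i\<close> is just carried along by
  \<open>mv\<close>, and \<open>fall_mv\<close> takes over below.\<close>

lemma fall_R2_above:
  assumes "i < l" "C \<subseteq> R (Suc l)"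
  shows "fall R2 l C = fall R l C"
  using assms
proof (induction l arbitrary: C)
  case (Suc l)
  show ?case
  proof (cases "l = i")
    case False
    then have "fall R2 l (occ C (R (Suc l))) = fall R l (occ C (R (Suc l)))"
      using Suc by (intro Suc.IH) (auto intro: occ_subset[THEN subsetD])
    then show ?thesis using False by (simp add: R2_simps)
  next
    case True
    let ?S = "R (Suc i)"
    have C: "C \<subseteq> R (Suc (Suc i))" using Suc.prems(2) True by simp
    have fS: "finite ?S" "finite C"
      using stackD(1)[OF stack, of "Suc i"] stackD(1)[OF stack, of "Suc (Suc i)"] C
      by (auto intro: finite_subset)
    have cC: "card C \<le> card ?S"
      using card_mono[OF stackD(1)[OF stack] C] stackD(2)[OF stack, of "Suc i"] by simp
    have nC: "c \<noteq> a \<and> c \<noteq> Suc a" if "c \<in> C" for c using C above that by auto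
    have cmp: "c \<le> s \<longleftrightarrow> id c \<le> mv s" if "c \<in> C" "s \<in> ?S" for c s
      using nC[OF that(1)] by (auto simp: mv_def)
    have sm: "strict_mono_on ?S mv"
      using car(2) by (auto simp: monotone_on_def mv_def) (metis less_antisym)
    have T: "occ C (mv ` ?S) = mv ` occ C ?S" "nwraps C (mv ` ?S) = nwraps C ?S"
      using occ_transport[OF fS cC sm, of id] cmp by auto
    have "fall R2 i (mv ` occ C ?S) = fall R i (mv ` occ C ?S)"
      by (rule fall_cong) (auto simp: R2_simps)
    also have "\<dots> = fall R i (occ C ?S)"
    proof (rule fall_mv[OF occ_subset])
      assume a: "0 < a" "a - 1 \<in> ?S" "Suc a \<in> occ C ?S"
      show "a - 1 \<in> occ C ?S"
      proof (rule occ_closed[OF fS a(2) car(1) _ _ a(3)])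
        show "a - 1 < Suc a" by simp
        show "c \<le> a - 1 \<or> Suc a < c" if "c \<in> C" for c using nC[OF that] by linarith
      qed
    qed
    finally show ?thesis using T True by (simp add: R2_simps)
  qed
qed simp

lemma layered_R2: "layered R2 L = layered R L"
  unfolding layered_def
proof (intro sum.cong refl)
  fix l
  consider "l < i" | "l = i" | "i < l" by linarith
  then show "fall R2 l (R2 (Suc l)) = fall R l (R (Suc l))"
  proof cases
    case 1
    then show ?thesis by (simp add: R2_simps, intro fall_cong) (auto simp: R2_simps)
  next
    case 2
    have "fall R2 i (mv ` R (Suc i)) = fall R i (mv ` R (Suc i))"
      by (rule fall_cong) (auto simp: R2_simps)
    then show ?thesis using 2 fall_mv[OF subset_refl] by (simp add: R2_simps)
  next
    case 3
    then show ?thesis using fall_R2_above[OF 3 subset_refl] by (simp add: R2_simps)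
  qed
qed

lemma stack_R2: "stack R2"
proof -
  have "card (R2 r) = card (R r) \<and> finite (R2 r)" if "1 \<le> r" for r
    using card_image[OF inj_mv[OF subset_refl]] stackD(1)[OF stack that]
    by (cases "r = Suc i") (auto simp: R2_simps)
  then show ?thesis using stack by (simp add: stack_def)
qed

end

section \<open>Adjacent swaps and Knuth moves on words\<close>

lemma nth_swap_adjacent:
  "(u @ c # b # v) ! j = (if j = length u then c else if j = Suc (length u) then b else (u @ b # c # v) ! j)"
  by (auto simp: nth_append nth_Cons' less_Suc_eq)

lemma card_pos: "card (pos w a) = count_list w a"
  by (simp add: pos_def count_list_eq_length_filter length_filter_conv_card eq_commute)

lemma stack_pos_mset:
  assumes "mset w = mset w'"
  shows "stack (pos w) \<longleftrightarrow> stack (pos w')"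
proof -
  have "count_list w a = count_list w' a" for a using assms by (metis count_mset)
  then show ?thesis by (simp add: stack_def card_pos)
qed

text \<open>Only positions of equal or consecutive letters are ever compared, and the transposition
  reverses a single pair, whose letters are neither.\<close>

lemma layered_swap_far:
  fixes u v :: "nat list" and b c :: nat
  defines "w \<equiv> u @ b # c # v"
  assumes "stack (pos w)" "b \<noteq> c" "b \<noteq> Suc c" "c \<noteq> Suc b"
  shows "layered (pos (u @ c # b # v)) L = layered (pos w) L"
proof -
  define a where "a = length u"
  define g where "g = (\<lambda>j. if j = a then Suc a else if j = Suc a then a else j)"
  have at: "w ! a = b" "w ! Suc a = c" by (auto simp: w_def a_def nth_append)
  have ord: "x \<le> y \<longleftrightarrow> g x \<le> g y" if "x \<in> pos w r" "y \<in> pos w s" "x \<noteq> y" "s = r \<or> r = Suc s" for x y r s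
  proof -
    have "\<not> (x = a \<and> y = Suc a) \<and> \<not> (x = Suc a \<and> y = a)"
      using that at assms(3-5) by (auto simp: pos_def)
    then show ?thesis using that(3) by (auto simp: g_def)
  qed
  show ?thesis
  proof (rule layered_transport[where g = "\<lambda>_. g", OF assms(2)], intro conjI)
    fix r
    have gi: "g x \<noteq> g y" if "x \<noteq> y" for x y using that by (auto simp: g_def split: if_splits)
    show "strict_mono_on (pos w r) g"
      unfolding monotone_on_def
    proof (intro ballI impI)
      fix x y
      assume "x \<in> pos w r" "y \<in> pos w r" "x < y"
      then show "g x < g y" using ord[of x r y r] gi[of x y] by (simp add: le_less)
    qed
    have inv: "g (g x) = x" for x by (auto simp: g_def)
    have nth: "(u @ c # b # v) ! j = w ! g j" for j
      using at unfolding nth_swap_adjacent[of u c b v j] w_def[symmetric] g_def a_def by auto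
    have len: "g j < length w \<longleftrightarrow> j < length w" for j by (auto simp: g_def a_def w_def)
    have "length (u @ c # b # v) = length w" by (simp add: w_def)
    then have "pos (u @ c # b # v) r = {j. g j \<in> pos w r}"
      unfolding pos_def nth by (simp add: len)
    also have "\<dots> = g ` pos w r"
    proof (intro equalityI subsetI)
      fix j
      assume "j \<in> {j. g j \<in> pos w r}"
      then show "j \<in> g ` pos w r" using inv[of j] by (intro image_eqI[of _ _ "g j"]) simp_all
    qed (auto simp: inv)
    finally show "pos (u @ c # b # v) r = g ` pos w r" .
  next
    fix r x y
    assume "x \<in> pos w (Suc r)" "y \<in> pos w r"
    then show "x \<le> y \<longleftrightarrow> g x \<le> g y" using ord[of x "Suc r" y r] by (auto simp: pos_def)
  qed
qed

lemma layered_swap_near: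
  fixes u v :: "nat list" and i :: nat
  defines "w \<equiv> u @ i # Suc i # v"
  assumes "stack (pos w)" "1 \<le> i"
    "(\<exists>v'. v = i # v') \<or> (\<exists>u'. u = u' @ [Suc i])"
  shows "layered (pos (u @ Suc i # i # v)) L = layered (pos w) L"
proof -
  define a where "a = length u"
  have at: "w ! a = i" "w ! Suc a = Suc i" "Suc a < length w" by (auto simp: w_def a_def nth_append)
  have wit: "Suc (Suc a) < length w \<and> w ! Suc (Suc a) = i \<or> 0 < a \<and> w ! (a - 1) = Suc i"
    using assms(4) by (auto simp: w_def a_def nth_append)
  interpret shift "pos w" i a
    using assms(2,3) at wit by unfold_locales (auto simp: pos_def)
  have pos': "pos (u @ Suc i # i # v) r =
      (if r = i then insert (Suc a) (pos w i - {a}) else if r = Suc i then insert a (pos w r - {Suc a}) else pos w r)" for r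
    using at unfolding pos_def nth_swap_adjacent[of u "Suc i" i v] w_def[symmetric] a_def[symmetric]
    by (auto simp: a_def w_def)
  \<comment> \<open>\<open>R2\<close> leaves the ball of row \<open>i\<close> at \<open>a\<close>,
    in one column with the moved ball; in the actual word it stands at \<open>Suc a\<close>. Weak
    comparison makes the two pictures equivalent.\<close>
  define g where "g = (\<lambda>r s. if r = i \<and> s = a then Suc a else s)"
  have "layered (pos (u @ Suc i # i # v)) L = layered R2 L"
  proof (rule layered_transport[where g = g, OF stack_R2], intro conjI)
    fix r
    have "Suc a \<notin> pos w i" using spot by simp
    then show "strict_mono_on (R2 r) (g r)"
      by (cases "r = i") (auto simp: monotone_on_def g_def R2_def, metis Suc_lessI)
    show "pos (u @ Suc i # i # v) r = g r ` R2 r"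
      using spot by (force simp: pos' g_def R2_def)
  next
    fix r c s
    assume rcs: "1 \<le> r" "c \<in> R2 (Suc r)" "s \<in> R2 r"
    show "c \<le> s \<longleftrightarrow> g (Suc r) c \<le> g r s"
    proof (cases "r = i")
      case True
      then have "c \<noteq> Suc a" using rcs by (auto simp: R2_def)
      then show ?thesis using True by (auto simp: g_def)
    next
      case False
      have "s \<noteq> a" if "Suc r = i" using rcs(3) that below by (auto simp: R2_def)
      then show ?thesis using False by (auto simp: g_def)
    qed
  qed
  then show ?thesis by (simp add: layered_R2)
qed

inductive kstep :: "nat list \<Rightarrow> nat list \<Rightarrow> bool" where
  k1: "x \<le> y \<Longrightarrow> y < z \<Longrightarrow> kstep (u @ x # z # y # v) (u @ z # x # y # v)"
| k2: "x < y \<Longrightarrow> y \<le> z \<Longrightarrow> kstep (u @ y # x # z # v) (u @ y # z # x # v)"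

lemma kstep_mset: "kstep w w' \<Longrightarrow> mset w = mset w'"
  by (induction rule: kstep.induct) auto

text \<open>Both moves exchange \<open>x\<close> and \<open>z\<close>. If \<open>z = Suc x\<close>,
  the inequalities force \<open>y = x\<close> or \<open>y = z\<close> respectively, so the third
  letter is a witness; otherwise the letters are too far apart to be compared.\<close>

lemma layered_kstep:
  assumes "kstep w w'" "stack (pos w)" "0 \<notin> set w"
  shows "layered (pos w') L = layered (pos w) L"
  using assms
proof cases
  case (k1 x y z u v)
  show ?thesis
  proof (cases "z = Suc x")
    case True
    then have "y = x" using k1 by simp
    then show ?thesis
      using layered_swap_near[of u x "y # v" L] k1 True assms(2,3) by auto
  next
    case False
    then show ?thesis
      using layered_swap_far[of u x z "y # v" L] k1 assms(2) by auto
  qed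
next
  case (k2 x y z u v)
  show ?thesis
  proof (cases "z = Suc x")
    case True
    then have "y = z" using k2 by simp
    then show ?thesis
      using layered_swap_near[of "u @ [y]" x v L] k2 True assms(2,3) by auto
  next
    case False
    then show ?thesis
      using layered_swap_far[of "u @ [y]" x z v L] k2 assms(2) by auto
  qed
qed

abbreviation knuth :: "nat list \<Rightarrow> nat list \<Rightarrow> bool" where
  "knuth \<equiv> equivclp kstep"

lemma knuth_mset: "knuth w w' \<Longrightarrow> mset w = mset w'"
  by (induction rule: equivclp_induct) (auto dest: kstep_mset)

lemma knuth_layered:
  assumes "knuth w w'" "stack (pos w)" "0 \<notin> set w"
  shows "layered (pos w') L = layered (pos w) L"
  using assms(1)
proof (induction rule: equivclp_induct)
  case (step x y)
  have "mset w = mset x" using knuth_mset step.hyps(1) .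
  moreover from this have "mset w = mset y" using step.hyps(2) kstep_mset by metis
  ultimately have "stack (pos x)" "0 \<notin> set x" "stack (pos y)" "0 \<notin> set y"
    using assms stack_pos_mset mset_eq_setD by metis+
  then show ?case using layered_kstep step by metis
qed simp

section \<open>Collapsing on words\<close>

text \<open>Reading a word from right to left, \<open>dep i d w\<close> is the number of letters \<open>i\<close> still waiting for
  a letter \<open>Suc i\<close>, when \<open>d\<close> such letters come from the part to the right of \<open>w\<close>.\<close>
primrec dep :: "nat \<Rightarrow> nat \<Rightarrow> nat list \<Rightarrow> nat" where
  "dep i d [] = d"
| "dep i d (x # w) =
     (if x = i then Suc (dep i d w) else if x = Suc i then dep i d w - 1 else dep i d w)"

text \<open>Whether a letter is lowered depends only on what follows it, summarised by
  \<open>d\<close>; thus the effect of a Knuth move can be examined on its three letters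
  alone.\<close>

primrec lower :: "nat \<Rightarrow> nat \<Rightarrow> nat list \<Rightarrow> nat list" where
  "lower i d [] = []"
| "lower i d (x # w) = (if x = Suc i \<and> dep i d w = 0 then i else x) # lower i d w"

lemma dep_append: "dep i d (u @ v) = dep i (dep i d v) u"
  by (induction u) auto

lemma lower_append: "lower i d (u @ v) = lower i (dep i d v) u @ lower i d v"
  by (induction u) (auto simp: dep_append)

lemma lower_other:
  "i \<notin> set w \<Longrightarrow> Suc i \<notin> set w \<Longrightarrow> dep i d w = d \<and> lower i d w = w"
  by (induction w) auto

lemma knuth_intros:
  "x \<le> y \<Longrightarrow> y < z \<Longrightarrow> knuth (u @ x # z # y # v) (u @ z # x # y # v)"
  "x \<le> y \<Longrightarrow> y < z \<Longrightarrow> knuth (u @ z # x # y # v) (u @ x # z # y # v)"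
  "x < y \<Longrightarrow> y \<le> z \<Longrightarrow> knuth (u @ y # x # z # v) (u @ y # z # x # v)"
  "x < y \<Longrightarrow> y \<le> z \<Longrightarrow> knuth (u @ y # z # x # v) (u @ y # x # z # v)"
  by (blast intro: kstep.intros)+

text \<open>Three cases for \<open>d\<close> suffice: the letters of a Knuth triple are not all
  equal, so at most two of them are \<open>Suc i\<close> and any larger supply acts like 2.\<close>

lemma lower_k1:
  assumes "x \<le> y" "y < z"
  shows "dep i d [x, z, y] = dep i d [z, x, y]"
    "knuth (u @ lower i d [x, z, y] @ v) (u @ lower i d [z, x, y] @ v)"
proof -
  consider "d = 0" | "d = 1" | e where "d = Suc (Suc e)" by (metis One_nat_def not0_implies_Suc)
  note d = this
  show "dep i d [x, z, y] = dep i d [z, x, y]" using assms by auto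
  show "knuth (u @ lower i d [x, z, y] @ v) (u @ lower i d [z, x, y] @ v)"
    using d
    by cases (cases "x = i"; cases "x = Suc i"; cases "y = i"; cases "y = Suc i";
      use assms in \<open>auto intro: knuth_intros\<close>)+
qed

text \<open>Here the kind of move can change: for \<open>d = 0\<close>, the triples
  \<open>[Suc i, i, Suc i]\<close> and \<open>[Suc i, Suc i, i]\<close> become
  \<open>[Suc i, i, i]\<close> and \<open>[i, Suc i, i]\<close>, related by a move of the first
  kind.\<close>

lemma lower_k2:
  assumes "x < y" "y \<le> z"
  shows "dep i d [y, x, z] = dep i d [y, z, x]"
    "knuth (u @ lower i d [y, x, z] @ v) (u @ lower i d [y, z, x] @ v)"
proof -
  consider "d = 0" | "d = 1" | e where "d = Suc (Suc e)" by (metis One_nat_def not0_implies_Suc)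
  note d = this
  show "dep i d [y, x, z] = dep i d [y, z, x]" using assms by auto
  show "knuth (u @ lower i d [y, x, z] @ v) (u @ lower i d [y, z, x] @ v)"
    using d
    by cases (cases "x = i"; cases "x = Suc i"; cases "y = i"; cases "y = Suc i";
      use assms in \<open>auto intro: knuth_intros\<close>)+
qed

lemma kstep_lower:
  assumes "kstep w w'"
  shows "knuth (lower i 0 w) (lower i 0 w')"
  using assms
proof cases
  case (k1 x y z u v)
  have "w = u @ [x, z, y] @ v" "w' = u @ [z, x, y] @ v" using k1 by auto
  then show ?thesis
    using lower_k1[OF k1(3,4), where i = i and d = "dep i 0 v"] by (simp only: lower_append dep_append)
next
  case (k2 x y z u v)
  have "w = u @ [y, x, z] @ v" "w' = u @ [y, z, x] @ v" using k2 by auto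
  then show ?thesis
    using lower_k2[OF k2(3,4), where i = i and d = "dep i 0 v"] by (simp only: lower_append dep_append)
qed

lemma knuth_lower: "knuth w w' \<Longrightarrow> knuth (lower i 0 w) (lower i 0 w')"
proof (induction rule: equivclp_induct)
  case (step y z)
  then show ?case using kstep_lower equivclp_sym equivclp_trans by metis
qed simp

text \<open>The letters \<open>i\<close> left without a partner inside \<open>w\<close> number
  \<open>dep i 0 w\<close>, and each pops one stack entry while any remain; the guard
  \<open>p < k\<close> excludes positions inside \<open>w\<close>.\<close>

lemma unm_stack:
  "p < k \<Longrightarrow> p \<in> unm i w k st \<longleftrightarrow> p \<in> set (drop (dep i 0 w) st)"
proof (induction w arbitrary: k st)
  case (Cons x w)
  show ?case
  proof (cases "x = Suc i")
    case True
    then show ?thesis using Cons by (cases "dep i 0 w") auto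
  next
    case False
    then show ?thesis using Cons by (cases st) auto
  qed
qed simp

lemma unm_at:
  assumes "q < length w" "w ! q = Suc i" "\<forall>p\<in>set st. p < k"
  shows "k + q \<in> unm i w k st \<longleftrightarrow> dep i 0 (drop (Suc q) w) = 0"
  using assms
proof (induction w arbitrary: k st q)
  case (Cons x w)
  show ?case
  proof (cases q)
    case 0
    then have "k \<in> unm i (x # w) k st \<longleftrightarrow> k \<in> set (drop (dep i 0 w) (k # st))"
      using Cons.prems(2) by (simp add: unm_stack)
    also have "\<dots> \<longleftrightarrow> dep i 0 w = 0"
      using Cons.prems(3) by (cases "dep i 0 w") (auto dest: in_set_dropD)
    finally show ?thesis using 0 by simp
  next
    case (Suc r)
    have q: "r < length w" "w ! r = Suc i" using Cons.prems Suc by auto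
    note IH = Cons.IH[OF q, of _ "Suc k"]
    have "\<forall>p\<in>set st. p < Suc k" "\<forall>p\<in>set (k # st). p < Suc k" "\<forall>p\<in>set (tl st). p < Suc k"
      using Cons.prems(3) by (cases st; auto simp: less_Suc_eq)+
    then show ?thesis
      using IH[of st] IH[of "k # st"] IH[of "tl st"] Suc by (cases st) auto
  qed
qed simp

lemma unm_bound: "unm i w k st \<subseteq> set st \<union> {k..<k + length w}"
proof (induction w arbitrary: k st)
  case (Cons x w)
  show ?case
    using Cons.IH[of "Suc k" st] Cons.IH[of "Suc k" "k # st"] Cons.IH[of "Suc k" "tl st"]
    by (cases st) auto
qed simp

primrec fallers :: "nat \<Rightarrow> nat \<Rightarrow> (nat \<times> nat) list \<Rightarrow> nat set" where
  "fallers i d [] = {}"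
| "fallers i d (c # cs) =
     (if fst c = Suc i \<and> dep i d (map fst cs) = 0 then {snd c} else {}) \<union> fallers i d cs"

lemma fallers_append:
  "fallers i d (us @ vs) = fallers i (dep i d (map fst vs)) us \<union> fallers i d vs"
  by (induction us) (auto simp: dep_append)

lemma fallers_nth:
  "fallers i 0 cs = {snd (cs ! q) | q. q < length cs \<and> fst (cs ! q) = Suc i \<and> dep i 0 (drop (Suc q) (map fst cs)) = 0}"
proof (induction cs)
  case (Cons c cs)
  let ?P = "\<lambda>cs q. q < length cs \<and> fst (cs ! q) = Suc i \<and> dep i 0 (drop (Suc q) (map fst cs)) = 0"
  have "{snd ((c # cs) ! q) | q. ?P (c # cs) q} =
    (if fst c = Suc i \<and> dep i 0 (map fst cs) = 0 then {snd c} else {}) \<union> {snd (cs ! q) | q. ?P cs q}"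
  proof (intro equalityI subsetI)
    fix x
    assume "x \<in> {snd ((c # cs) ! q) | q. ?P (c # cs) q}"
    then obtain q where "x = snd ((c # cs) ! q)" "?P (c # cs) q" by blast
    then show "x \<in> (if fst c = Suc i \<and> dep i 0 (map fst cs) = 0 then {snd c} else {}) \<union> {snd (cs ! q) | q. ?P cs q}"
      by (cases q) auto
  next
    fix x
    assume x: "x \<in> (if fst c = Suc i \<and> dep i 0 (map fst cs) = 0 then {snd c} else {}) \<union> {snd (cs ! q) | q. ?P cs q}"
    show "x \<in> {snd ((c # cs) ! q) | q. ?P (c # cs) q}"
    proof (cases "x \<in> {snd (cs ! q) | q. ?P cs q}")
      case True
      then obtain q where "x = snd (cs ! q)" "?P cs q" by blast
      then have "x = snd ((c # cs) ! Suc q)" "?P (c # cs) (Suc q)" by auto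
      then show ?thesis by blast
    next
      case False
      then have "x = snd ((c # cs) ! 0)" "?P (c # cs) 0" using x by (auto split: if_splits)
      then show ?thesis by blast
    qed
  qed
  then show ?case using Cons by simp
qed simp

section \<open>Column words and the collapsing operators\<close>

definition colw :: "nat set list \<Rightarrow> nat \<Rightarrow> nat list" where
  "colw B j = filter (\<lambda>r. j \<in> row B r) (rev [1..<length B + 1])"

definition colc :: "nat set list \<Rightarrow> nat \<Rightarrow> (nat \<times> nat) list" where
  "colc B j = map (\<lambda>r. (r, j)) (colw B j)"

lemma cw_cells_cols: "cw_cells n B = concat (map (colc B) [1..<n + 1])"
  by (simp add: cw_cells_def colc_def[abs_def] colw_def del: upt_Suc)

lemma map_fst_cols: "map fst (concat (map (colc B) js)) = concat (map (colw B) js)"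
  by (induction js) (auto simp: colc_def o_def)

lemma cw_cols: "cw n B = concat (map (colw B) [1..<n + 1])"
  by (simp only: cw_def cw_cells_cols map_fst_cols)

text \<open>Replaces the left-to-right stack by the right-to-left counter, which can be followed
  column by column.\<close>

lemma e_star_fallers:
  "e_star n i B = (let U = fallers i 0 (cw_cells n B)
     in B[i - 1 := B ! (i - 1) \<union> U, i := B ! i - U])"
proof -
  let ?c = "cw_cells n B"
  have "(k \<in> unmatched_pos i (cw n B) \<and> cw n B ! k = Suc i) \<longleftrightarrow>
      (k < length ?c \<and> fst (?c ! k) = Suc i \<and> dep i 0 (drop (Suc k) (map fst ?c)) = 0)" for k
  proof -
    have "k \<in> unmatched_pos i (cw n B) \<Longrightarrow> k < length (cw n B)"
      using unm_bound[of i "cw n B" 0 "[]"] by (auto simp: unmatched_pos_def)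
    then show ?thesis
      using unm_at[of k "cw n B" i "[]" 0] by (auto simp: unmatched_pos_def cw_def)
  qed
  then have "{snd (?c ! k) | k. k \<in> unmatched_pos i (cw n B) \<and> cw n B ! k = Suc i} = fallers i 0 ?c"
    by (simp only: fallers_nth)
  then show ?thesis by (simp add: e_star_def Let_def)
qed

text \<open>\<open>u\<close> is the decision that the ball in row \<open>Suc i\<close> of column
  \<open>j\<close> falls.\<close>

definition moved :: "nat set list \<Rightarrow> nat \<Rightarrow> bool \<Rightarrow> nat \<Rightarrow> nat \<Rightarrow> bool" where
  "moved B i u j r = (if r = i then j \<in> row B i \<or> u else if r = Suc i then j \<in> row B (Suc i) \<and> \<not> u
     else j \<in> row B r)"

lemma rev_upt_split:
  assumes "1 \<le> i" "i < L"
  shows "rev [1..<L + 1] = rev [i + 2..<L + 1] @ [Suc i, i] @ rev [1..<i]"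
proof -
  have "[1..<L + 1] = [1..<i] @ [i..<L + 1]" using upt_add_eq_append[of 1 i "L + 1 - i"] assms by simp
  also have "[i..<L + 1] = i # Suc i # [i + 2..<L + 1]" using assms by (simp add: upt_conv_Cons)
  finally show ?thesis by simp
qed

text \<open>In one column \<open>Suc i\<close> is read immediately before \<open>i\<close>, so a
  ball above an occupied cell is matched. A ball therefore falls only into an empty cell, and
  lowering its letter keeps the column decreasing.\<close>

lemma column_lower:
  assumes "1 \<le> i" "i < length B"
  defines "u \<equiv> \<lambda>d j. j \<in> row B (Suc i) \<and> j \<notin> row B i \<and> d = 0"
  shows "lower i d (colw B j) = filter (moved B i (u d j) j) (rev [1..<length B + 1])"
    "fallers i d (colc B j) = (if u d j then {j} else {})"
proof -
  let ?f = "filter (\<lambda>r. j \<in> row B r)"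
  define hi where "hi = rev [i + 2..<length B + 1]"
  define lo where "lo = rev [1..<i]"
  have split: "rev [1..<length B + 1] = hi @ [Suc i, i] @ lo"
    unfolding hi_def lo_def by (rule rev_upt_split[OF assms(1,2)])
  have nin: "i \<notin> set hi" "Suc i \<notin> set hi" "i \<notin> set lo" "Suc i \<notin> set lo"
    by (auto simp: hi_def lo_def)
  have lo: "dep i d (?f lo) = d" "lower i d (?f lo) = ?f lo" for d
    using lower_other[of i "?f lo" d] nin by auto
  have hi: "dep i d (?f hi) = d" "lower i d (?f hi) = ?f hi" for d
    using lower_other[of i "?f hi" d] nin by auto
  have mv: "filter (moved B i b j) hi = ?f hi" "filter (moved B i b j) lo = ?f lo" for b
    by (rule filter_cong[OF refl], use nin in \<open>auto simp: moved_def\<close>)+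
  show "lower i d (colw B j) = filter (moved B i (u d j) j) (rev [1..<length B + 1])"
    unfolding colw_def split filter_append lower_append mv hi(2) lo
    by (auto simp: u_def moved_def)
  have fo: "fallers i d (map (\<lambda>r. (r, j)) xs) = {}" if "Suc i \<notin> set xs" for d xs
    using that by (induction xs) auto
  have "Suc i \<notin> set (?f hi)" "Suc i \<notin> set (?f lo)" using nin by auto
  note fo = this[THEN fo]
  have "map fst (map (\<lambda>r. (r, j)) xs) = xs" for xs by (simp add: o_def)
  then show "fallers i d (colc B j) = (if u d j then {j} else {})"
    unfolding colw_def colc_def split filter_append map_append fallers_append fo
    by (auto simp: u_def lo o_def)
qed

lemma fallers_cols_subset: "fallers i d (concat (map (colc B) js)) \<subseteq> {j \<in> set js. j \<in> row B (Suc i)}"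
proof -
  have "fallers i d cs \<subseteq> snd ` {c \<in> set cs. fst c = Suc i}" for cs by (induction cs) auto
  then show ?thesis by (fastforce simp: colc_def colw_def)
qed

lemma cols_lower:
  assumes "1 \<le> i" "i < length B" "distinct js"
  shows "lower i 0 (concat (map (colw B) js)) =
    concat (map (\<lambda>j. filter (moved B i (j \<in> fallers i 0 (concat (map (colc B) js))) j) (rev [1..<length B + 1])) js)"
  using assms(3)
proof (induction js)
  case (Cons j js)
  define d where "d = dep i 0 (concat (map (colw B) js))"
  note C = column_lower[OF assms(1,2), of d j]
  have F: "fallers i 0 (concat (map (colc B) (j # js))) =
    fallers i d (colc B j) \<union> fallers i 0 (concat (map (colc B) js))"
    by (simp add: fallers_append map_fst_cols d_def)
  have "j \<notin> fallers i 0 (concat (map (colc B) js))"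
    using fallers_cols_subset[of i 0 B js] Cons.prems by auto
  then have j: "j \<in> fallers i 0 (concat (map (colc B) (j # js))) \<longleftrightarrow>
    j \<in> row B (Suc i) \<and> j \<notin> row B i \<and> d = 0"
    unfolding F C(2) by auto
  have js: "x \<in> fallers i 0 (concat (map (colc B) (j # js))) \<longleftrightarrow>
    x \<in> fallers i 0 (concat (map (colc B) js))" if "x \<in> set js" for x
    unfolding F C(2) using that Cons.prems by auto
  have "lower i 0 (concat (map (colw B) (j # js))) =
    lower i d (colw B j) @ lower i 0 (concat (map (colw B) js))"
    by (simp add: lower_append d_def)
  also have "lower i 0 (concat (map (colw B) js)) =
    concat (map (\<lambda>x. filter (moved B i (x \<in> fallers i 0 (concat (map (colc B) (j # js)))) x) (rev [1..<length B + 1])) js)"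
    using Cons js by (auto intro!: arg_cong[of _ _ concat] map_cong simp del: upt_Suc)
  finally show ?case unfolding C(1) j[symmetric] by (simp del: upt_Suc)
qed simp

lemma row_e_star:
  assumes "1 \<le> i" "i < length B" "1 \<le> r" "r \<le> length B"
  shows "j \<in> row (e_star n i B) r \<longleftrightarrow> moved B i (j \<in> fallers i 0 (cw_cells n B)) j r"
  using assms by (auto simp: e_star_fallers Let_def row_def moved_def nth_list_update)

lemma length_e_star [simp]: "length (e_star n i B) = length B"
  by (simp add: e_star_def Let_def)

lemma cw_e_star:
  assumes "1 \<le> i" "i < length B"
  shows "cw n (e_star n i B) = lower i 0 (cw n B)"
proof -
  have "lower i 0 (cw n B) =
    concat (map (\<lambda>j. filter (moved B i (j \<in> fallers i 0 (cw_cells n B)) j) (rev [1..<length B + 1])) [1..<n + 1])"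
    unfolding cw_cols cw_cells_cols by (rule cols_lower[OF assms]) simp
  also have "\<dots> = concat (map (colw (e_star n i B)) [1..<n + 1])"
    unfolding colw_def length_e_star
    using row_e_star[OF assms] by (intro arg_cong[of _ _ concat] map_cong filter_cong refl) auto
  finally show ?thesis by (simp only: cw_cols)
qed

lemma e_star_rows:
  assumes "1 \<le> i" "i < length B" "\<And>r. r \<in> {1..length B} \<Longrightarrow> row B r \<subseteq> {1..n}" "r \<in> {1..length B}"
  shows "row (e_star n i B) r \<subseteq> {1..n}"
proof
  fix j
  assume "j \<in> row (e_star n i B) r"
  then have "moved B i (j \<in> fallers i 0 (cw_cells n B)) j r"
    using row_e_star assms by simp
  moreover have "fallers i 0 (cw_cells n B) \<subseteq> {1..n}"
    unfolding cw_cells_cols using fallers_cols_subset[of i 0 B "[1..<n + 1]"] by auto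
  ultimately show "j \<in> {1..n}"
    using assms(1,2) assms(3)[of i] assms(3)[of "Suc i"] assms(3)[OF assms(4)] assms(4)
    by (auto simp: moved_def split: if_splits)
qed

section \<open>Columns of a matrix versus positions in its column word\<close>

lemma set_cw_cells:
  assumes "\<And>r. r \<in> {1..length B} \<Longrightarrow> row B r \<subseteq> {1..n}"
  shows "(r, j) \<in> set (cw_cells n B) \<longleftrightarrow> j \<in> rows B r"
proof -
  have "(r, j) \<in> set (colc B x) \<longleftrightarrow> x = j \<and> 1 \<le> r \<and> r \<le> length B \<and> j \<in> row B r" for x
    by (auto simp: colc_def colw_def)
  then have "(r, j) \<in> set (cw_cells n B) \<longleftrightarrow> j \<in> {1..n} \<and> 1 \<le> r \<and> r \<le> length B \<and> j \<in> row B r"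
    unfolding cw_cells_cols by (auto simp del: upt_Suc)
  moreover have "j \<in> {1..n}" if "1 \<le> r" "r \<le> length B" "j \<in> row B r"
    using assms[of r] that by auto
  ultimately show ?thesis by (auto simp: rows_def)
qed

lemma sorted_cw_cells:
  "sorted_wrt (\<lambda>c d. snd c < snd d \<or> snd c = snd d \<and> fst d < fst c) (cw_cells n B)"
proof -
  have col: "sorted_wrt (\<lambda>c d. snd c < snd d \<or> snd c = snd d \<and> fst d < fst c) (colc B j)" for j
  proof -
    have "sorted_wrt (<) [1..<length B + 1]" by (rule sorted_wrt_upt)
    then have "sorted_wrt (\<lambda>x y. y < x) (rev [1..<length B + 1])" by (simp only: sorted_wrt_rev)
    then have "sorted_wrt (\<lambda>x y. y < x) (colw B j)" unfolding colw_def by (rule sorted_wrt_filter)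
    then show ?thesis by (simp add: colc_def sorted_wrt_map)
  qed
  have "sorted_wrt (\<lambda>c d. snd c < snd d \<or> snd c = snd d \<and> fst d < fst c) (concat (map (colc B) js))"
    if "sorted_wrt (<) js" for js
    using that
  proof (induction js)
    case (Cons j js)
    have snd: "snd c = j" if "c \<in> set (colc B j)" for c j using that by (auto simp: colc_def)
    have "snd c < snd d" if c: "c \<in> set (colc B j)" and d: "d \<in> set (concat (map (colc B) js))" for c d
    proof -
      from d obtain j' where "j' \<in> set js" "d \<in> set (colc B j')" by auto
      then show ?thesis using snd[OF c] snd[of d j'] Cons.prems by simp
    qed
    then show ?case using Cons.IH Cons.prems col[of j] by (simp add: sorted_wrt_append)
  qed simp
  from this[of "[1..<n + 1]"] show ?thesis unfolding cw_cells_cols using sorted_wrt_upt by blast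
qed

text \<open>Where columns tie, the reading direction decides: a column is read downwards, so
  \<open>Suc r\<close> precedes the \<open>r\<close> of its column, in agreement with the weak
  comparison of columns.\<close>

lemma cells_pos:
  assumes "\<And>r. r \<in> {1..length B} \<Longrightarrow> row B r \<subseteq> {1..n}"
  defines "g \<equiv> \<lambda>p. snd (cw_cells n B ! p)"
  shows "strict_mono_on (pos (cw n B) r) g" "g ` pos (cw n B) r = rows B r"
    "c \<in> pos (cw n B) (Suc r) \<Longrightarrow> s \<in> pos (cw n B) r \<Longrightarrow> c \<le> s \<longleftrightarrow> g c \<le> g s"
proof -
  let ?cs = "cw_cells n B"
  have pos: "p \<in> pos (cw n B) r \<longleftrightarrow> p < length ?cs \<and> fst (?cs ! p) = r" for p r
    by (auto simp: pos_def cw_def)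
  have srt: "g p < g q \<or> g p = g q \<and> fst (?cs ! q) < fst (?cs ! p)" if "p < q" "q < length ?cs" for p q
    using sorted_wrt_nth_less[OF sorted_cw_cells that] by (simp add: g_def)
  show "strict_mono_on (pos (cw n B) r) g"
    unfolding monotone_on_def
  proof (intro ballI impI)
    fix p q
    assume "p \<in> pos (cw n B) r" "q \<in> pos (cw n B) r" "p < q"
    then show "g p < g q" using srt[of p q] pos by auto
  qed
  have "g ` pos (cw n B) r = {j. (r, j) \<in> set ?cs}"
  proof (intro equalityI subsetI)
    fix j
    assume "j \<in> {j. (r, j) \<in> set ?cs}"
    then obtain p where "p < length ?cs" "?cs ! p = (r, j)" by (auto simp: in_set_conv_nth)
    then show "j \<in> g ` pos (cw n B) r" using pos by (intro image_eqI[of _ _ p]) (auto simp: g_def)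
  next
    fix j
    assume "j \<in> g ` pos (cw n B) r"
    then obtain p where "p < length ?cs" "fst (?cs ! p) = r" "j = snd (?cs ! p)"
      using pos by (auto simp: g_def)
    then have "(r, j) = ?cs ! p" by (metis prod.collapse)
    then show "j \<in> {j. (r, j) \<in> set ?cs}" using \<open>p < length ?cs\<close> by simp
  qed
  then show "g ` pos (cw n B) r = rows B r" using set_cw_cells[OF assms(1)] by auto
  show "c \<le> s \<longleftrightarrow> g c \<le> g s" if "c \<in> pos (cw n B) (Suc r)" "s \<in> pos (cw n B) r"
  proof -
    have "c \<noteq> s" using that pos by auto
    then consider "c < s" | "s < c" by linarith
    then show ?thesis using srt[of c s] srt[of s c] that pos by cases auto
  qed
qed

lemma count_cw:
  assumes "\<And>r. r \<in> {1..length B} \<Longrightarrow> row B r \<subseteq> {1..n}"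
  shows "count_list (cw n B) r = card (rows B r)"
  using card_image[OF strict_mono_on_imp_inj_on[OF cells_pos(1)[OF assms]]] cells_pos(2)[OF assms]
  by (metis card_pos)

lemma layered_rows_cw:
  assumes "\<And>r. r \<in> {1..length B} \<Longrightarrow> row B r \<subseteq> {1..n}" "stack (pos (cw n B))"
  shows "layered (rows B) L = layered (pos (cw n B)) L"
proof (rule layered_transport[where g = "\<lambda>_ p. snd (cw_cells n B ! p)", OF assms(2)])
  fix r
  show "strict_mono_on (pos (cw n B) r) (\<lambda>p. snd (cw_cells n B ! p)) \<and>
    rows B r = (\<lambda>p. snd (cw_cells n B ! p)) ` pos (cw n B) r"
    using cells_pos(1)[OF assms(1)] cells_pos(2)[OF assms(1), symmetric] by (rule conjI)
next
  fix r c s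
  assume "c \<in> pos (cw n B) (Suc r)" "s \<in> pos (cw n B) r"
  then show "c \<le> s \<longleftrightarrow> snd (cw_cells n B ! c) \<le> snd (cw_cells n B ! s)"
    using cells_pos(3)[of B n c r s] assms(1) by blast
qed

section \<open>Row insertion\<close>

lemma knuth_append:
  assumes "knuth a b"
  shows "knuth (p @ a @ q) (p @ b @ q)"
  using assms
proof (induction rule: equivclp_induct)
  case (step y z)
  have "kstep (p @ c @ q) (p @ d @ q)" if "kstep c d" for c d
    using that
  proof cases
    case (k1 x y z u v)
    then show ?thesis using kstep.k1[of x y z "p @ u" "v @ q"] by simp
  next
    case (k2 x y z u v)
    then show ?thesis using kstep.k2[of x y z "p @ u" "v @ q"] by simp
  qed
  then have "knuth (p @ y @ q) (p @ z @ q)" using step.hyps(2) by blast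
  with step.IH show ?case by (rule equivclp_trans)
qed simp

text \<open>First half of an insertion step: \<open>x\<close> passes left through the tail behind
  the bumped entry \<open>y\<close>, each time with the preceding entry as third letter of a
  move.\<close>

lemma knuth_bump_right:
  "x < y \<Longrightarrow> sorted (y # v) \<Longrightarrow> knuth (y # v @ [x]) (y # x # v)"
proof (induction v arbitrary: y)
  case (Cons a v)
  have "knuth (a # v @ [x]) (a # x # v)" using Cons by auto
  then have "knuth (y # a # v @ [x]) (y # a # x # v)"
    using knuth_append[of _ _ "[y]" "[]"] by simp
  moreover have "knuth (y # a # x # v) (y # x # a # v)"
    using knuth_intros(4)[of x y a "[]" v] Cons.prems by simp
  ultimately show ?case using equivclp_trans by simp
qed simp

text \<open>Second half: \<open>y\<close> leaves through the front of the row, with the entry to its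
  right as third letter.\<close>

lemma knuth_bump_left:
  "x < y \<Longrightarrow> sorted (u @ [x]) \<Longrightarrow> knuth (u @ y # x # v) (y # u @ x # v)"
proof (induction u arbitrary: x v rule: rev_induct)
  case (snoc a u)
  have a: "a \<le> x" "sorted (u @ [a])" using snoc.prems by (auto simp: sorted_append)
  have "knuth (u @ a # y # x # v) (u @ y # a # x # v)"
    using knuth_intros(1)[of a x y u v] a snoc.prems by simp
  moreover have "knuth (u @ y # a # x # v) (y # u @ a # x # v)"
    using snoc.IH[of a "x # v"] a snoc.prems by simp
  ultimately show ?case using equivclp_trans by simp
qed simp

text \<open>Schensted row insertion.\<close>

fun tins :: "nat \<Rightarrow> nat list list \<Rightarrow> nat list list" where
  "tins x [] = [[x]]"
| "tins x (R # T) = (case dropWhile (\<lambda>a. a \<le> x) R of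
      [] \<Rightarrow> (R @ [x]) # T
    | y # v \<Rightarrow> (takeWhile (\<lambda>a. a \<le> x) R @ x # v) # tins y T)"

definition above :: "nat list \<Rightarrow> nat list \<Rightarrow> bool" where
  "above R S \<longleftrightarrow> length S \<le> length R \<and> (\<forall>i<length S. R ! i < S ! i)"

definition bottom :: "nat list list \<Rightarrow> nat list" where
  "bottom T = (case T of [] \<Rightarrow> [] | R # _ \<Rightarrow> R)"

primrec ssyt :: "nat list list \<Rightarrow> bool" where
  "ssyt [] = True"
| "ssyt (R # T) \<longleftrightarrow> sorted R \<and> above R (bottom T) \<and> ssyt T"

lemma tins_cases:
  assumes "sorted R"
  obtains "\<forall>a\<in>set R. a \<le> x" "tins x (R # T) = (R @ [x]) # T"
  | u y v where "R = u @ y # v" "\<forall>a\<in>set u. a \<le> x" "x < y" "\<forall>a\<in>set v. y \<le> a"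
      "tins x (R # T) = (u @ x # v) # tins y T"
proof (cases "dropWhile (\<lambda>a. a \<le> x) R")
  case Nil
  then have "\<forall>a\<in>set R. a \<le> x" by (simp add: dropWhile_eq_Nil_conv)
  moreover have "tins x (R # T) = (R @ [x]) # T" by (simp only: tins.simps Nil list.case)
  ultimately show thesis by (rule that(1))
next
  case (Cons y v)
  have R: "R = takeWhile (\<lambda>a. a \<le> x) R @ y # v" using takeWhile_dropWhile_id[of "\<lambda>a. a \<le> x" R] Cons by simp
  have "\<not> y \<le> x" using hd_dropWhile[of "\<lambda>a. a \<le> x" R] Cons by simp
  moreover have "\<forall>a\<in>set v. y \<le> a" using assms by (subst (asm) R) (auto simp: sorted_append)
  ultimately show thesis using R Cons by (intro that(2)[OF R]) (auto dest: set_takeWhileD)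
qed

text \<open>The bumped \<open>y\<close> moves weakly left: an entry over its old column is larger
  than \<open>y\<close>, so the search in the next row stops no later. Up to that column the new row
  stays below \<open>y\<close>, and elsewhere its entries have not grown.\<close>

lemma above_tins:
  assumes "above (u @ y # v) (bottom T)" "ssyt T" "\<forall>a\<in>set u. a \<le> x" "x < y"
  shows "above (u @ x # v) (bottom (tins y T))"
proof -
  let ?R = "u @ y # v" and ?R' = "u @ x # v" and ?c = "length u"
  have R': "?R' ! i = (if i = ?c then x else ?R ! i)" for i by (simp add: nth_append nth_Cons')
  have low: "?R' ! i < y" if "i \<le> ?c" for i
  proof (cases "i = ?c")
    case False
    then have "?R ! i \<in> set u" using that by (simp add: nth_append)
    then show ?thesis using R' False assms(3,4) by fastforce
  qed (use R' assms(4) in simp)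
  have keep: "?R' ! i < s" if "?R ! i < s" for i s
    using that R'[of i] assms(4) by (auto simp: nth_append)
  show ?thesis
  proof (cases T)
    case Nil
    then show ?thesis using low[of 0] by (simp add: above_def bottom_def)
  next
    case (Cons S T')
    have ab: "above ?R S" "sorted S" using assms(1,2) Cons by (auto simp: bottom_def)
    show ?thesis
    proof (cases rule: tins_cases[OF ab(2), of y T'])
      case 1
      have "length S \<le> ?c"
      proof (rule ccontr)
        assume "\<not> length S \<le> ?c"
        then have "?c < length S" by simp
        then have "?R ! ?c < S ! ?c" "S ! ?c \<in> set S" using ab(1) unfolding above_def by (blast, simp)
        then show False using 1(1) by auto
      qed
      then have "above ?R' (S @ [y])"
        unfolding above_def using low keep ab(1)
        by (auto simp: nth_append less_Suc_eq above_def)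
      then show ?thesis using 1 Cons by (simp add: bottom_def)
    next
      case (2 u2 z v2)
      let ?d = "length u2"
      have "?d \<le> ?c"
      proof (rule ccontr)
        assume "\<not> ?d \<le> ?c"
        then have "?c < length u2" "?c < length S" using 2(1) by auto
        then have "?R ! ?c < S ! ?c" "S ! ?c \<in> set u2"
          using ab(1) unfolding above_def by (blast, simp add: 2(1) nth_append)
        then show False using 2(2) by auto
      qed
      moreover have S': "(u2 @ y # v2) ! i = (if i = ?d then y else S ! i)" for i
        by (simp add: 2(1) nth_append nth_Cons')
      ultimately have "above ?R' (u2 @ y # v2)"
        unfolding above_def S' using low keep ab(1) 2(1) by (auto simp: above_def)
      then show ?thesis using 2 Cons by (simp add: bottom_def)
    qed
  qed
qed

lemma ssyt_tins: "ssyt T \<Longrightarrow> ssyt (tins x T) \<and> knuth (rrw T @ [x]) (rrw (tins x T))"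
proof (induction T arbitrary: x)
  case Nil
  show ?case by (simp add: rrw_def above_def bottom_def)
next
  case (Cons R T)
  have R: "sorted R" "above R (bottom T)" "ssyt T" using Cons.prems by auto
  show ?case
  proof (cases rule: tins_cases[OF R(1), of x T])
    case 1
    then show ?thesis using R by (auto simp: rrw_def sorted_append above_def nth_append)
  next
    case (2 u y v)
    have srt: "sorted u" "sorted (y # v)" "sorted (u @ [x])" "sorted (u @ x # v)"
      using R(1) 2 by (fastforce simp: sorted_append)+
    have "knuth (rrw T @ R @ [x]) (rrw T @ u @ y # x # v)"
      using knuth_append[OF knuth_bump_right[OF 2(3) srt(2)], of "rrw T @ u" "[]"] 2(1) by simp
    also have "knuth (rrw T @ u @ y # x # v) (rrw T @ y # u @ x # v)"
      using knuth_append[OF knuth_bump_left[OF 2(3) srt(3)], of "rrw T" "[]" v] by simp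
    also have "knuth (rrw T @ y # u @ x # v) (rrw (tins y T) @ u @ x # v)"
      using knuth_append[of "rrw T @ [y]" "rrw (tins y T)" "[]" "u @ x # v"] Cons.IH[OF R(3)] by simp
    finally have "knuth (rrw T @ R @ [x]) (rrw (tins y T) @ u @ x # v)" .
    moreover have "ssyt ((u @ x # v) # tins y T)"
      using srt(4) above_tins[of u y v T x] R 2 Cons.IH[OF R(3)] by simp
    ultimately show ?thesis using 2(5) by (simp add: rrw_def)
  qed
qed

lemma knuth_tableau: "\<exists>T. ssyt T \<and> knuth w (rrw T)"
proof (induction w rule: rev_induct)
  case Nil
  have "ssyt [] \<and> knuth [] (rrw [])" by (simp add: rrw_def)
  then show ?case by blast
next
  case (snoc x w)
  then obtain T where T: "ssyt T" "knuth w (rrw T)" by blast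
  have "knuth (w @ [x]) (rrw T @ [x])" using knuth_append[OF T(2), of "[]" "[x]"] by simp
  then have "knuth (w @ [x]) (rrw (tins x T))" using ssyt_tins[OF T(1)] equivclp_trans by metis
  then show ?case using ssyt_tins[OF T(1)] by blast
qed

section \<open>Rows of a tableau, padded with empty rows\<close>

definition trow :: "nat list list \<Rightarrow> nat \<Rightarrow> nat list" where
  "trow T r = (if r - 1 < length T then T ! (r - 1) else [])"

lemma trow_Cons: "trow (R # T) r = (if r \<le> 1 then R else trow T (r - 1))"
  by (auto simp: trow_def nth_Cons' diff_le_mono less_diff_conv)

lemma ssyt_trow:
  "ssyt T \<Longrightarrow> 1 \<le> r \<Longrightarrow> sorted (trow T r) \<and> above (trow T r) (trow T (Suc r))"
proof (induction T arbitrary: r)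
  case (Cons R T)
  show ?case
  proof (cases "r = 1")
    case True
    have "trow T 1 = bottom T" by (cases T) (auto simp: trow_def bottom_def)
    then show ?thesis using True Cons.prems by (simp add: trow_Cons)
  next
    case False
    then show ?thesis using Cons.IH[of "r - 1"] Cons.prems by (simp add: trow_Cons)
  qed
qed (simp add: trow_def above_def)

lemma trow_entry_ge:
  assumes "ssyt T" "0 \<notin> set (rrw T)" "1 \<le> r" "x \<in> set (trow T r)"
  shows "r \<le> x"
  using assms(3,4)
proof (induction r arbitrary: x rule: dec_induct)
  case base
  have "x \<in> set (rrw T)" using base by (auto simp: trow_def rrw_def split: if_splits)
  then have "x \<noteq> 0" using assms(2) by metis
  then show ?case by simp
next
  case (step r)
  then obtain i where i: "i < length (trow T (Suc r))" "x = trow T (Suc r) ! i"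
    by (auto simp: in_set_conv_nth)
  have "above (trow T r) (trow T (Suc r))" using ssyt_trow[OF assms(1)] step.hyps by blast
  then have "trow T r ! i < x" "trow T r ! i \<in> set (trow T r)" using i by (auto simp: above_def)
  then show ?case using step.IH by fastforce
qed

lemma rrw_trow:
  assumes "length T \<le> K"
  shows "rrw T = concat (map (trow T) (rev [1..<K + 1]))"
  using assms
proof (induction K rule: dec_induct)
  case base
  have "map (trow T) [1..<length T + 1] = T"
    by (rule nth_equalityI) (auto simp: trow_def simp del: upt_Suc)
  then show ?case by (metis rrw_def rev_map)
next
  case (step K)
  then show ?case by (simp add: trow_def)
qed

section \<open>Collapsing a tableau\<close>

definition tlet :: "nat \<Rightarrow> nat \<Rightarrow> nat \<Rightarrow> nat \<Rightarrow> nat" where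
  "tlet k j r x = (if x < k then r else if x = k then max r j else x)"

text \<open>\<open>tstate T K k j\<close> is the reading word of \<open>T\<close> once the letters below \<open>k\<close> have dropped to the
  number of their row and the letters \<open>k\<close> have dropped to \<open>j\<close>, or to their row if that is higher.\<close>
definition tstate :: "nat list list \<Rightarrow> nat \<Rightarrow> nat \<Rightarrow> nat \<Rightarrow> nat list" where
  "tstate T K k j = concat (map (\<lambda>r. map (tlet k j r) (trow T r)) (rev [1..<K + 1]))"

lemma lower_no_match:
  "j \<notin> set w \<Longrightarrow> dep j 0 w = 0 \<and> lower j 0 w = map (\<lambda>x. if x = Suc j then j else x) w"
  by (induction w) auto

lemma lower_matched:
  assumes "j \<notin> set w" "count_list w (Suc j) \<le> d"
  shows "dep j d w = d - count_list w (Suc j) \<and> lower j d w = w"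
  using assms by (induction w) auto

lemma sorted_filter_split:
  "sorted xs \<Longrightarrow> xs = filter (\<lambda>x. x < (k::nat)) xs @ filter (\<lambda>x. k \<le> x) xs"
proof (induction xs)
  case (Cons a xs)
  show ?case
  proof (cases "a < k")
    case True
    then show ?thesis using Cons by simp
  next
    case False
    then have "filter (\<lambda>x. x < k) xs = []" "filter (\<lambda>x. k \<le> x) xs = xs"
      using Cons.prems by (auto simp: filter_empty_conv filter_id_conv)
    then show ?thesis using False by simp
  qed
qed simp

lemma sorted_filter_nth:
  assumes "sorted xs" "i < length (filter (\<lambda>x. x \<le> (k::nat)) xs)"
  shows "xs ! i \<le> k"
proof -
  have f: "filter (\<lambda>x. x < Suc k) xs = filter (\<lambda>x. x \<le> k) xs" by (simp add: less_Suc_eq_le)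
  have "xs ! i = filter (\<lambda>x. x \<le> k) xs ! i"
    using sorted_filter_split[OF assms(1), of "Suc k"] assms(2) unfolding f by (metis nth_append)
  then show ?thesis using nth_mem[OF assms(2)] by simp
qed

text \<open>The entries up to \<open>k\<close> form an initial part of \<open>S\<close> and sit on
  strictly smaller entries of \<open>R\<close>. This is how column strictness enters the
  collapsing.\<close>

lemma above_count:
  assumes "sorted R" "sorted S" "above R S"
  shows "length (filter (\<lambda>x. x \<le> k) S) \<le> length (filter (\<lambda>x. x < k) R)"
proof -
  let ?p = "length (filter (\<lambda>x. x \<le> k) S)"
  have p: "?p \<le> length S" by simp
  have "x < k" if x: "x \<in> set (take ?p R)" for x
  proof -
    obtain i where i: "i < ?p" "i < length R" "x = R ! i" using x by (auto simp: in_set_conv_nth)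
    have "i < length S" using i(1) p by linarith
    then have "R ! i < S ! i" using assms(3) by (auto simp: above_def)
    then show ?thesis using sorted_filter_nth[OF assms(2) i(1)] i(3) by simp
  qed
  then have "filter (\<lambda>x. x < k) (take ?p R) = take ?p R" by (auto intro: filter_True)
  then have "filter (\<lambda>x. x < k) R = take ?p R @ filter (\<lambda>x. x < k) (drop ?p R)"
    by (metis append_take_drop_id filter_append)
  then have "length (filter (\<lambda>x. x < k) R) \<ge> length (take ?p R)" by simp
  moreover have "?p \<le> length R" using p assms(3) unfolding above_def by linarith
  ultimately show ?thesis by simp
qed

lemma dep_replicate: "dep j d (replicate q j) = d + q \<and> lower j d (replicate q j) = replicate q j"
  by (induction q) auto

text \<open>Read from the right. Below row \<open>j\<close> no letter \<open>j\<close> occurs, so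
  every \<open>k\<close>, currently written \<open>Suc j\<close>, drops. In row \<open>j\<close> the
  letters \<open>k\<close> come after all letters \<open>j\<close> and drop too; the entries less
  than \<open>k\<close> in front leave \<open>q\<close> waiting letters \<open>j\<close>. By
  \<open>above_count\<close> row \<open>Suc j\<close> has at most \<open>q\<close> letters
  \<open>Suc j\<close>, all matched, and higher rows contain neither letter.\<close>

lemma lower_tstate:
  assumes T: "ssyt T" and j: "1 \<le> j" "j < k" "j < K"
  shows "lower j 0 (tstate T K k (Suc j)) = tstate T K k j"
proof -
  define g where "g = (\<lambda>b r. map (tlet k b r) (trow T r))"
  define hi where "hi = (\<lambda>b. concat (map (g b) (rev [j + 2..<K + 1])))"
  define lo where "lo = (\<lambda>b. concat (map (g b) (rev [1..<j])))"
  have ts: "tstate T K k b = hi b @ g b (Suc j) @ g b j @ lo b" for b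
    unfolding tstate_def g_def hi_def lo_def rev_upt_split[OF j(1,3)] by simp
  let ?h = "\<lambda>x. if x = Suc j then j else x"
  have tl: "?h (tlet k (Suc j) r x) = tlet k j r x" if "r < j \<or> r = j \<and> k \<le> x" for r x
    using that j by (auto simp: tlet_def)
  have "j \<notin> set (lo (Suc j))" using j by (auto simp: lo_def g_def tlet_def)
  moreover have "map ?h (lo (Suc j)) = lo j"
    unfolding lo_def g_def map_concat map_map comp_def
    by (intro arg_cong[of _ _ concat] map_cong refl tl) auto
  ultimately have lo: "dep j 0 (lo (Suc j)) = 0" "lower j 0 (lo (Suc j)) = lo j"
    using lower_no_match by auto
  note srt = ssyt_trow[OF T]
  let ?R = "trow T j" and ?S = "trow T (Suc j)"
  define q where "q = length (filter (\<lambda>x. x < k) ?R)"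
  have row: "g b j = replicate q j @ map (tlet k b j) (filter (\<lambda>x. k \<le> x) ?R)" for b
  proof -
    have "map (tlet k b j) (filter (\<lambda>x. x < k) ?R) = replicate q j"
      unfolding q_def by (rule replicate_eqI) (auto simp: tlet_def)
    then show ?thesis
      using sorted_filter_split[of ?R k] srt[OF j(1)] unfolding g_def by (metis map_append)
  qed
  let ?m = "map (tlet k (Suc j) j) (filter (\<lambda>x. k \<le> x) ?R)"
  have "j \<notin> set ?m" using j by (auto simp: tlet_def)
  moreover have "map ?h ?m = map (tlet k j j) (filter (\<lambda>x. k \<le> x) ?R)"
    unfolding map_map comp_def by (intro map_cong refl tl) auto
  ultimately have m: "dep j 0 ?m = 0" "lower j 0 ?m = map (tlet k j j) (filter (\<lambda>x. k \<le> x) ?R)"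
    using lower_no_match by auto
  have rowj: "dep j 0 (g (Suc j) j) = q" "lower j 0 (g (Suc j) j) = g j j"
    unfolding row by (simp_all add: dep_append lower_append m dep_replicate)
  have up: "g (Suc j) (Suc j) = g j (Suc j)"
    unfolding g_def by (intro map_cong refl) (auto simp: tlet_def)
  have "count_list (g (Suc j) (Suc j)) (Suc j) = length (filter (\<lambda>x. x \<le> k) ?S)"
    unfolding g_def count_list_eq_length_filter filter_map length_map
    using j by (intro arg_cong[of _ _ length] filter_cong) (auto simp: tlet_def)
  also have "\<dots> \<le> q"
    unfolding q_def using srt[OF j(1)] srt[of "Suc j"] by (intro above_count) auto
  finally have cnt: "count_list (g (Suc j) (Suc j)) (Suc j) \<le> q" .
  have "j \<notin> set (g (Suc j) (Suc j))" using j by (auto simp: g_def tlet_def)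
  then have rowS: "lower j q (g (Suc j) (Suc j)) = g j (Suc j)"
    using lower_matched cnt up by simp
  have hi_eq: "hi (Suc j) = hi j"
    unfolding hi_def g_def by (intro arg_cong[of _ _ concat] map_cong refl) (auto simp: tlet_def)
  have "j \<notin> set (hi j)" "Suc j \<notin> set (hi j)" using j by (auto simp: hi_def g_def tlet_def)
  then have hi: "lower j d (hi j) = hi j" for d using lower_other by blast
  show ?thesis
    unfolding ts lower_append dep_append lo rowj rowS hi_eq hi by simp
qed

text \<open>At the end of phase \<open>k\<close> all letters up to \<open>k\<close> equal their row
  number; the letters \<open>Suc k\<close> are still untouched, as they lie in rows up to
  \<open>Suc k\<close>.\<close>

lemma tstate_next:
  assumes "ssyt T" "0 \<notin> set (rrw T)"
  shows "tstate T K (Suc k) (Suc k) = tstate T K k 1"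
  unfolding tstate_def
proof (intro arg_cong[of _ _ concat] map_cong refl)
  fix r x
  assume r: "r \<in> set (rev [1..<K + 1])" and x: "x \<in> set (trow T r)"
  then have "r \<le> x" using trow_entry_ge[OF assms, of r x] by auto
  then show "tlet (Suc k) (Suc k) r x = tlet k 1 r x" using r by (auto simp: tlet_def)
qed

lemma tstate_init:
  assumes "ssyt T" "0 \<notin> set (rrw T)" "length T \<le> K"
  shows "tstate T K 1 1 = rrw T"
  unfolding tstate_def rrw_trow[OF assms(3)]
proof (intro arg_cong[of _ _ concat] map_cong refl)
  fix r
  assume r: "r \<in> set (rev [1..<K + 1])"
  have "tlet 1 1 r x = x" if "x \<in> set (trow T r)" for x
    using trow_entry_ge[OF assms(1,2) _ that] r by (auto simp: tlet_def)
  then show "map (tlet 1 1 r) (trow T r) = trow T r" by (simp add: map_idI)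
qed

text \<open>The factor \<open>e_range n 1 k\<close> walks the letters \<open>Suc k\<close> down to
  their rows while all other letters stay put.\<close>

lemma collapse_knuth:
  assumes T: "ssyt T" "0 \<notin> set (rrw T)" "length T \<le> K" "knuth (cw n B) (rrw T)"
    and L: "length B \<le> K" and rows: "\<And>r. r \<in> {1..length B} \<Longrightarrow> row B r \<subseteq> {1..n}"
    and k: "1 \<le> k" "k \<le> length B"
  shows "knuth (cw n (collapse_upto n k B)) (tstate T K k 1) \<and> length (collapse_upto n k B) = length B \<and>
    (\<forall>r\<in>{1..length B}. row (collapse_upto n k B) r \<subseteq> {1..n})"
  using k
proof (induction k rule: dec_induct)
  case base
  then show ?case using T rows tstate_init[OF T(1-3)] by (simp add: collapse_upto_def)
next
  case (step k)
  define C where "C = collapse_upto n k B"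
  have C: "knuth (cw n C) (tstate T K (Suc k) (Suc k))" "length C = length B"
    "\<forall>r\<in>{1..length B}. row C r \<subseteq> {1..n}"
    using step.IH step.prems tstate_next[OF T(1,2)] by (auto simp: C_def)
  \<comment> \<open>State after the operators with indices from \<open>k\<close> down to
    \<open>j\<close>.\<close>
  have "1 \<le> j \<Longrightarrow> knuth (cw n (fold (e_star n) (rev [j..<Suc k]) C)) (tstate T K (Suc k) j) \<and>
      length (fold (e_star n) (rev [j..<Suc k]) C) = length B \<and>
      (\<forall>r\<in>{1..length B}. row (fold (e_star n) (rev [j..<Suc k]) C) r \<subseteq> {1..n})" if "j \<le> Suc k" for j
    using that
  proof (induction j rule: inc_induct)
    case base
    then show ?case using C by simp
  next
    case (step j)
    define D where "D = fold (e_star n) (rev [Suc j..<Suc k]) C"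
    have D: "knuth (cw n D) (tstate T K (Suc k) (Suc j))" "length D = length B"
      "\<And>r. r \<in> {1..length D} \<Longrightarrow> row D r \<subseteq> {1..n}"
      using step.IH by (auto simp: D_def)
    have jj: "1 \<le> j" "j < length D" "j < Suc k" "j < K"
      using step.hyps step.prems \<open>Suc k \<le> length B\<close> D(2) L by auto
    have "rev [j..<Suc k] = rev [Suc j..<Suc k] @ [j]"
      using step.hyps by (subst upt_rec) simp
    then have eq: "fold (e_star n) (rev [j..<Suc k]) C = e_star n j D" by (simp add: D_def)
    have "knuth (cw n (e_star n j D)) (tstate T K (Suc k) j)"
      using knuth_lower[OF D(1), of j] cw_e_star[OF jj(1,2)] lower_tstate[OF T(1) jj(1,3,4)] by simp
    then show ?case
      unfolding eq using D(2) e_star_rows[OF jj(1,2) D(3)] by simp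
  qed
  from this[of 1] have "knuth (cw n (e_range n 1 k C)) (tstate T K (Suc k) 1) \<and>
      length (e_range n 1 k C) = length B \<and> (\<forall>r\<in>{1..length B}. row (e_range n 1 k C) r \<subseteq> {1..n})"
    by (simp add: e_range_def del: upt_Suc)
  moreover have "collapse_upto n (Suc k) B = e_range n 1 k C"
    using step.hyps by (simp add: collapse_upto_def C_def)
  ultimately show ?case by simp
qed

section \<open>Reading off the recording tableau\<close>

lemma count_list_concat_single:
  assumes "distinct rs" "r \<in> set rs" "\<And>r'. r' \<in> set rs \<Longrightarrow> r' \<noteq> r \<Longrightarrow> x \<notin> set (g r')"
  shows "count_list (concat (map g rs)) x = count_list (g r) x"
  using assms
proof (induction rs)
  case (Cons a rs)
  show ?case
  proof (cases "a = r")
    case True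
    then have "x \<notin> set (concat (map g rs))" using Cons.prems by auto
    then show ?thesis using True by (simp add: count_notin)
  next
    case False
    then have "x \<notin> set (g a)" using Cons.prems(3)[of a] by simp
    then show ?thesis using Cons False by (simp add: count_notin)
  qed
qed simp

lemma count_tstate:
  assumes "1 \<le> r" "r \<le> k" "r \<le> K"
  shows "count_list (tstate T K k 1) r = length (filter (\<lambda>x. x \<le> k) (trow T r))"
proof -
  have "count_list (tstate T K k 1) r = count_list (map (tlet k 1 r) (trow T r)) r"
    unfolding tstate_def
  proof (rule count_list_concat_single)
    show "distinct (rev [1..<K + 1])" by simp
    show "r \<in> set (rev [1..<K + 1])" using assms by (simp add: less_Suc_eq_le del: upt_Suc)
    show "r \<notin> set (map (tlet k 1 r') (trow T r'))" if "r' \<in> set (rev [1..<K + 1])" "r' \<noteq> r" for r'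
      using that assms by (auto simp: tlet_def split: if_splits)
  qed
  also have "\<dots> = length (filter (\<lambda>x. x \<le> k) (trow T r))"
    unfolding count_list_eq_length_filter filter_map length_map
    using assms by (intro arg_cong[of _ _ length] filter_cong) (auto simp: tlet_def)
  finally show ?thesis .
qed

text \<open>Knuth equivalence does not determine the collapsed matrix, but it preserves the number
  of letters \<open>r\<close>, which is the size of row \<open>r\<close>, and that is all
  \<open>rhoQ\<close> reads off.\<close>

lemma card_row_Nk:
  assumes T: "ssyt T" "0 \<notin> set (rrw T)" "length T \<le> K" "knuth (cw n B) (rrw T)"
    and L: "length B \<le> K" and rows: "\<And>r. r \<in> {1..length B} \<Longrightarrow> row B r \<subseteq> {1..n}"
    and k: "k \<le> length B" and r: "1 \<le> r"
  shows "card_row (Nk n B k) r = length (filter (\<lambda>x. x \<le> k) (trow T r))"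
proof (cases "r \<le> k")
  case True
  let ?C = "collapse_upto n k B"
  have C: "knuth (cw n ?C) (tstate T K k 1)" "length ?C = length B"
    "\<And>r. r \<in> {1..length ?C} \<Longrightarrow> row ?C r \<subseteq> {1..n}"
    using collapse_knuth[OF T L rows, of k] k r True by auto
  have "card_row (Nk n B k) r = card (rows ?C r)"
    using True k r C(2) by (simp add: card_row_def Nk_def row_def rows_def)
  also have "\<dots> = count_list (cw n ?C) r" using count_cw[OF C(3)] by simp
  also have "\<dots> = count_list (tstate T K k 1) r" using knuth_mset[OF C(1)] by (metis count_mset)
  also have "\<dots> = length (filter (\<lambda>x. x \<le> k) (trow T r))" using count_tstate r True k L by simp
  finally show ?thesis .
next
  case False
  then have "filter (\<lambda>x. x \<le> k) (trow T r) = []"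
    using trow_entry_ge[OF T(1,2) r] by (fastforce simp: filter_empty_conv)
  moreover have "card_row (Nk n B k) r = 0" using False by (simp add: card_row_def Nk_def)
  ultimately show ?thesis by simp
qed

lemma filter_le_Suc:
  "sorted xs \<Longrightarrow> filter (\<lambda>x. x \<le> Suc k) xs = filter (\<lambda>x. x \<le> k) xs @
     replicate (length (filter (\<lambda>x. x \<le> Suc k) xs) - length (filter (\<lambda>x. x \<le> k) xs)) (Suc k)"
proof (induction xs)
  case (Cons a xs)
  show ?case
  proof (cases "a \<le> k")
    case True
    then show ?thesis using Cons by simp
  next
    case False
    then have "filter (\<lambda>x. x \<le> k) (a # xs) = []"
      using Cons.prems by (fastforce simp: filter_empty_conv)
    moreover have "\<forall>x\<in>set (filter (\<lambda>x. x \<le> Suc k) (a # xs)). x = Suc k"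
    proof
      fix x
      assume "x \<in> set (filter (\<lambda>x. x \<le> Suc k) (a # xs))"
      then have "a \<le> x" "x \<le> Suc k" using Cons.prems by (auto split: if_splits)
      then show "x = Suc k" using False by simp
    qed
    ultimately show ?thesis by (simp add: replicate_length_same del: filter.simps)
  qed
qed simp

lemma sorted_from_counts:
  assumes "sorted xs" "0 \<notin> set xs"
  shows "concat (map (\<lambda>i. replicate (length (filter (\<lambda>x. x \<le> i) xs) - length (filter (\<lambda>x. x \<le> i - 1) xs)) i) [1..<L + 1])
    = filter (\<lambda>x. x \<le> L) xs"
proof (induction L)
  case 0
  have "filter (\<lambda>x. x = 0) xs = []" using assms(2) by (intro filter_False) metis
  then show ?case by simp
next
  case (Suc L)
  then show ?case using filter_le_Suc[OF assms(1), of L] by simp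
qed

text \<open>Reading words are compared because \<open>rhoQ n B\<close> and \<open>T\<close> may
  differ by empty top rows.\<close>

lemma rrw_rhoQ:
  assumes T: "ssyt T" "knuth (cw n B) (rrw T)" and sub: "set (rrw T) \<subseteq> {1..length B}"
    and rows: "\<And>r. r \<in> {1..length B} \<Longrightarrow> row B r \<subseteq> {1..n}"
  shows "rrw (rhoQ n B) = rrw T"
proof -
  let ?L = "length B"
  \<comment> \<open>Bounds both the rows of \<open>T\<close> and the row indices met by the
    operators. Rows of \<open>T\<close> above \<open>length B\<close> turn out empty, as entries are
    at least their row number.\<close>
  define K where "K = max ?L (length T)"
  have K: "length T \<le> K" "?L \<le> K" by (auto simp: K_def)
  have z: "0 \<notin> set (rrw T)" using sub by auto
  have tr: "set (trow T r) \<subseteq> {1..?L}" for r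
    using sub by (fastforce simp: trow_def rrw_def)
  have "rhoQ n B = map (trow T) [1..<?L + 1]"
    unfolding rhoQ_def
  proof (intro map_cong refl)
    fix r
    assume "r \<in> set [1..<?L + 1]"
    then have r: "1 \<le> r" by auto
    have "concat (map (\<lambda>i. replicate (card_row (Nk n B i) r - card_row (Nk n B (i - 1)) r) i) [1..<?L + 1])
      = concat (map (\<lambda>i. replicate (length (filter (\<lambda>x. x \<le> i) (trow T r)) - length (filter (\<lambda>x. x \<le> i - 1) (trow T r))) i) [1..<?L + 1])"
    proof (intro arg_cong[of _ _ concat] map_cong refl)
      fix i
      assume "i \<in> set [1..<?L + 1]"
      then have "i \<le> ?L" "i - 1 \<le> ?L" by auto
      then show "replicate (card_row (Nk n B i) r - card_row (Nk n B (i - 1)) r) i =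
        replicate (length (filter (\<lambda>x. x \<le> i) (trow T r)) - length (filter (\<lambda>x. x \<le> i - 1) (trow T r))) i"
        using card_row_Nk[OF T(1) z K(1) T(2) K(2) rows _ r] by simp
    qed
    also have "\<dots> = filter (\<lambda>x. x \<le> ?L) (trow T r)"
      using ssyt_trow[OF T(1) r] tr[of r] by (intro sorted_from_counts) auto
    also have "\<dots> = trow T r" using tr[of r] by (intro filter_True) auto
    finally show "concat (map (\<lambda>i. replicate (card_row (Nk n B i) r - card_row (Nk n B (i - 1)) r) i) [1..<?L + 1])
      = trow T r" .
  qed
  then have "rrw (rhoQ n B) = concat (map (trow T) (rev [1..<?L + 1]))"
    by (simp only: rrw_def rev_map)
  also have "\<dots> = concat (map (trow T) (rev [1..<K + 1]))"
    using K(2)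
  proof (induction K rule: dec_induct)
    case (step K)
    have "trow T (Suc K) = []"
    proof (rule ccontr)
      assume "trow T (Suc K) \<noteq> []"
      then obtain x where "x \<in> set (trow T (Suc K))" by (cases "trow T (Suc K)") auto
      then show False using trow_entry_ge[OF T(1) z, of "Suc K" x] tr[of "Suc K"] step.hyps by fastforce
    qed
    then show ?case using step by simp
  qed simp
  also have "\<dots> = rrw T" using rrw_trow[OF K(1)] by simp
  finally show ?thesis .
qed

theorem theorem4p9:
  fixes lam :: "nat list" and n :: nat and M :: "nat set list"
  assumes "is_partition lam"
    and "length lam \<le> n"
    and "M \<in> MLQ lam n"
  shows "maj M = charge_tab (rhoQ n M)"
proof -
  let ?L = "length M" and ?w = "cw n M"
  have sub: "row M r \<subseteq> {1..n}" and card: "card (row M r) = conjp lam r" if "r \<in> {1..?L}" for r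
    using assms(3) that by (auto simp: MLQ_def)
  have st: "stack (rows M)"
    unfolding stack_def
  proof (intro allI impI conjI)
    fix r :: nat
    assume r: "1 \<le> r"
    show "finite (rows M r)" using sub[of r] by (auto simp: rows_def intro: finite_subset)
    have "conjp lam (Suc r) \<le> conjp lam r"
      unfolding conjp_def by (induction lam) auto
    then show "card (rows M (Suc r)) \<le> card (rows M r)"
      using card[of r] card[of "Suc r"] r by (auto simp: rows_def)
  qed
  have stw: "stack (pos ?w)"
    using st count_cw[OF sub] by (simp add: stack_def card_pos)
  obtain T where T: "ssyt T" "knuth ?w (rrw T)" using knuth_tableau by blast
  have ms: "mset ?w = mset (rrw T)" using knuth_mset[OF T(2)] .
  have "set ?w \<subseteq> {1..?L}"
    by (auto simp: cw_cols colw_def simp del: upt_Suc)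
  then have setT: "set (rrw T) \<subseteq> {1..?L}" and z: "0 \<notin> set ?w" using mset_eq_setD[OF ms] by auto
  have "charge_tab (rhoQ n M) = charge_word (rrw T)"
    using rrw_rhoQ[OF T setT sub] by (simp add: charge_tab_def)
  also have "\<dots> = layered (pos (rrw T)) ?L"
    unfolding charge_word_def using stw stack_pos_mset[OF ms] setT by (intro charge_aux_layered) auto
  also have "\<dots> = layered (pos ?w) ?L" by (rule knuth_layered[OF T(2) stw z])
  also have "\<dots> = layered (rows M) ?L" using layered_rows_cw[OF sub stw] by simp
  also have "\<dots> = maj M" using maj_layered[OF st] by simp
  finally show ?thesis by simp
qed

end
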